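(* Let $G$ be a finite simple graph on $[n]$ with edge ideal $I(G)\subset S=K[x_1,\dots,x_n]$. Then for all integers $k\ge1$, $$\mathrm{HS}_1(I(G)^{k})\ =\ \mathrm{Lin}_1(I(G)^{k})+I(G)^{\langle k+1\rangle}.$$
   Context: $K$ is a field, $S=K[x_1,\dots,x_n]$ is the standard graded polynomial ring, and for a monomial ideal $I\subset S$, $\mathcal{G}(I)$ denotes its minimal monomial generating set. For a finite simple graph $G$ with vertex set $[n]=\{1,\dots,n\}$ and edge set $E(G)$, the edge ideal $I(G)\subset S$ is the ideal generated by the monomials $x_ix_j$ with $\{i,j\}\in E(G)$. For ${\bf a}=(a_1,\dots,a_n)\in\mathbb{Z}_{\ge0}^n$ put ${\bf x}^{\bf a}=x_1^{a_1}\cdots x_n^{a_n}$. The $i$th homological shift ideal of a monomial ideal $I\subset S$ is $\mathrm{HS}_i(I)=({\bf x}^{\bf a} : \mathrm{Tor}_i^S(K,I)_{\bf a}\ne0)$, where $\mathrm{Tor}_i^S(K,I)_{\bf a}$ is the component of multidegree ${\bf a}$. For a monomial ideal $J\subset S$, $J_{\langle d\rangle}$ is the ideal generated by all monomials of degree $d$ belonging to $J$. If $I$ is a monomial ideal generated in degree $d$, its $i$th homological linear part is $\mathrm{Lin}_i(I)=\mathrm{HS}_i(I)_{\langle d+i\rangle}$. (The ideal $I(G)^k$ is generated in degree $2k$.) For a monomial ideal $I$ with $\mathcal{G}(I)=\{u_1,\dots,u_m\}$ and an integer $k\ge2$, the $k$th non-pure power of $I$ is $$I^{\langle k\rangle}=(u_{i_1}\cdots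 u_{i_k} : 1\le i_1\le\dots\le i_k\le m,\ |\{i_1,\dots,i_k\}|>1),$$ and $I^{\langle1\rangle}=I$ by convention. *)

theory Defs
  imports Complex_Main "HOL-Library.Poly_Mapping" "HOL-Library.Multiset" "HOL-Library.Set_Algebras"
begin

text \<open>
  For a finite type \<open>'n\<close>, the type \<open>('n, 'k) mpoly\<close> is the polynomial ring over \<open>'k\<close> with one
  variable for each element of \<open>'n\<close>; exponent vectors are finitely supported functions
  \<open>'n \<Rightarrow>\<^sub>0 nat\<close>, and multiplication is the convolution product of \<open>Poly_Mapping\<close>.
\<close>

type_synonym ('n, 'k) mpoly = "('n \<Rightarrow>\<^sub>0 nat) \<Rightarrow>\<^sub>0 'k"

definition xpow :: "('n \<Rightarrow>\<^sub>0 nat) \<Rightarrow> ('n, 'k::field) mpoly"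
  where "xpow a = Poly_Mapping.single a 1"

definition var :: "'n \<Rightarrow> ('n, 'k::field) mpoly"
  where "var i = xpow (Poly_Mapping.single i 1)"

definition total_deg :: "('n::finite \<Rightarrow>\<^sub>0 nat) \<Rightarrow> nat"
  where "total_deg a = (\<Sum>i\<in>UNIV. Poly_Mapping.lookup a i)"


section \<open>Ideals and monomial ideals\<close>

global_interpretation ring_module: module "(*) :: 'a::comm_ring_1 \<Rightarrow> 'a \<Rightarrow> 'a"
  defines ideal_gen = ring_module.span
  by unfold_locales (simp_all add: algebra_simps)

text \<open>
  Below, the sum \<open>I + J\<close> of ideals is the elementwise sum of sets from \<open>Set_Algebras\<close>. The
  elementwise product of that theory is not the product of ideals.
\<close>

definition ideal_prod :: "'a::comm_ring_1 set \<Rightarrow> 'a set \<Rightarrow> 'a set"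
  where "ideal_prod I J = ideal_gen {f * g | f g. f \<in> I \<and> g \<in> J}"

primrec ideal_pow :: "'a::comm_ring_1 set \<Rightarrow> nat \<Rightarrow> 'a set"
  where
    "ideal_pow I 0 = UNIV"
  | "ideal_pow I (Suc k) = ideal_prod I (ideal_pow I k)"

definition is_min_mono_gens :: "('n, 'k::field) mpoly set \<Rightarrow> ('n, 'k) mpoly set \<Rightarrow> bool"
  where "is_min_mono_gens I M \<longleftrightarrow>
    M \<subseteq> range xpow \<and> ideal_gen M = I \<and> (\<forall>M'. M' \<subset> M \<longrightarrow> ideal_gen M' \<noteq> I)"

definition min_mono_gens :: "('n, 'k::field) mpoly set \<Rightarrow> ('n, 'k) mpoly set"
  where "min_mono_gens I = (THE M. is_min_mono_gens I M)"

definition generated_in_degree :: "nat \<Rightarrow> ('n::finite, 'k::field) mpoly set \<Rightarrow> bool"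
  where "generated_in_degree d I \<longleftrightarrow> (\<exists>A. (\<forall>a\<in>A. total_deg a = d) \<and> I = ideal_gen (xpow ` A))"

text \<open>
  The generating degree is unique except for the zero ideal, which is generated in every degree
  (by the empty set) and for which any choice of \<open>d\<close> gives the same, zero, linear part.
\<close>

definition gen_degree :: "('n::finite, 'k::field) mpoly set \<Rightarrow> nat"
  where "gen_degree I = (SOME d. generated_in_degree d I)"

definition degree_part :: "('n::finite, 'k::field) mpoly set \<Rightarrow> nat \<Rightarrow> ('n, 'k) mpoly set"
  where "degree_part J d = ideal_gen {xpow a | a. xpow a \<in> J \<and> total_deg a = d}"

text \<open>
  The index sequences \<open>i\<^sub>1 \<le> \<dots> \<le> i\<^sub>k\<close> correspond to the multisets of size \<open>k\<close> of
  minimal generators.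
\<close>

definition nonpure_power :: "('n, 'k::field) mpoly set \<Rightarrow> nat \<Rightarrow> ('n, 'k) mpoly set"
  where "nonpure_power I k =
    (if k = 1 then I
     else ideal_gen {prod_mset U | U. set_mset U \<subseteq> min_mono_gens I \<and> size U = k
                                      \<and> card (set_mset U) > 1})"


section \<open>Multigraded Tor\<close>

text \<open>
  Data for an augmented complex \<open>\<dots> \<rightarrow> P\<^sub>1 \<rightarrow> P\<^sub>0 \<rightarrow> K\<close> of finitely generated free modules
  over the polynomial ring \<open>S\<close>, where \<open>K = S/(x\<^sub>1,\<dots>,x\<^sub>n)\<close>. The module \<open>P\<^sub>i\<close> has basis
  \<open>e\<^sub>b\<close>, \<open>b < rank P i\<close>, with \<open>e\<^sub>b\<close> of multidegree \<open>bdeg P i b\<close>. The differential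
  \<open>P\<^sub>i\<^sub>+\<^sub>1 \<rightarrow> P\<^sub>i\<close> sends \<open>e\<^sub>b\<close> to the sum of the \<open>entry P i b c \<cdot> e\<^sub>c\<close>, and the augmentation
  \<open>P\<^sub>0 \<rightarrow> K\<close> sends \<open>e\<^sub>c\<close> to \<open>aug P c\<close>.
\<close>

record (overloaded) ('n, 'k) free_complex =
  rank :: "nat \<Rightarrow> nat"
  bdeg :: "nat \<Rightarrow> nat \<Rightarrow> ('n \<Rightarrow>\<^sub>0 nat)"
  entry :: "nat \<Rightarrow> nat \<Rightarrow> nat \<Rightarrow> ('n, 'k) mpoly"
  aug :: "nat \<Rightarrow> 'k"

text \<open>
  The submodule \<open>J\<^sup>r\<close> of \<open>S\<^sup>r\<close>, with coordinate vectors extended by \<open>0\<close>. Since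
  \<open>P\<^sub>i\<close> is free, \<open>coord_vecs UNIV (rank P i)\<close> is \<open>P\<^sub>i\<close>, and for an ideal \<open>I\<close>,
  \<open>coord_vecs I (rank P i)\<close> is the tensor product of \<open>P\<^sub>i\<close> and \<open>I\<close> over \<open>S\<close>; the
  differential induced on it is given by the same matrix.
\<close>

definition coord_vecs :: "'a::zero set \<Rightarrow> nat \<Rightarrow> (nat \<Rightarrow> 'a) set"
  where "coord_vecs J r = {v. (\<forall>b<r. v b \<in> J) \<and> (\<forall>b\<ge>r. v b = 0)}"

definition differential :: "('n, 'k::field) free_complex \<Rightarrow> nat \<Rightarrow> (nat \<Rightarrow> ('n, 'k) mpoly) \<Rightarrow> nat \<Rightarrow> ('n, 'k) mpoly"
  where "differential P i v =
    (\<lambda>c. if c < rank P i then \<Sum>b<rank P (Suc i). v b * entry P i b c else 0)"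

text \<open>A polynomial acts on \<open>K\<close> through its constant coefficient.\<close>

definition augmentation :: "('n, 'k::field) free_complex \<Rightarrow> (nat \<Rightarrow> ('n, 'k) mpoly) \<Rightarrow> 'k"
  where "augmentation P v = (\<Sum>c<rank P 0. Poly_Mapping.lookup (v c) 0 * aug P c)"

text \<open>The differentials and the augmentation preserve multidegrees.\<close>

definition multigraded :: "('n, 'k::field) free_complex \<Rightarrow> bool"
  where "multigraded P \<longleftrightarrow>
    (\<forall>i. \<forall>b<rank P (Suc i). \<forall>c<rank P i. \<forall>m\<in>Poly_Mapping.keys (entry P i b c).
        m + bdeg P i c = bdeg P (Suc i) b) \<and>
    (\<forall>c<rank P 0. aug P c \<noteq> 0 \<longrightarrow> bdeg P 0 c = 0)"

definition free_resolution_of_field :: "('n, 'k::field) free_complex \<Rightarrow> bool"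
  where "free_resolution_of_field P \<longleftrightarrow>
    multigraded P \<and>
    augmentation P ` coord_vecs UNIV (rank P 0) = UNIV \<and>
    {v \<in> coord_vecs UNIV (rank P 0). augmentation P v = 0}
      = differential P 0 ` coord_vecs UNIV (rank P 1) \<and>
    (\<forall>i. {v \<in> coord_vecs UNIV (rank P (Suc i)). differential P i v = (\<lambda>_. 0)}
      = differential P (Suc i) ` coord_vecs UNIV (rank P (Suc (Suc i))))"

definition tensor_cycles :: "('n, 'k::field) free_complex \<Rightarrow> nat \<Rightarrow> ('n, 'k) mpoly set \<Rightarrow> (nat \<Rightarrow> ('n, 'k) mpoly) set"
  where "tensor_cycles P i I =
    {v \<in> coord_vecs I (rank P i). case i of 0 \<Rightarrow> True | Suc j \<Rightarrow> differential P j v = (\<lambda>_. 0)}"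

definition tensor_boundaries :: "('n, 'k::field) free_complex \<Rightarrow> nat \<Rightarrow> ('n, 'k) mpoly set \<Rightarrow> (nat \<Rightarrow> ('n, 'k) mpoly) set"
  where "tensor_boundaries P i I = differential P i ` coord_vecs I (rank P (Suc i))"

definition homogeneous_vecs :: "('n, 'k::field) free_complex \<Rightarrow> nat \<Rightarrow> ('n \<Rightarrow>\<^sub>0 nat) \<Rightarrow> (nat \<Rightarrow> ('n, 'k) mpoly) set"
  where "homogeneous_vecs P i a =
    {v. \<forall>b<rank P i. \<forall>m\<in>Poly_Mapping.keys (v b). m + bdeg P i b = a}"

text \<open>
  \<open>Tor\<^sub>i(K, I)\<^sub>a \<noteq> 0\<close>: tensoring a multigraded free resolution of \<open>K\<close> with \<open>I\<close>, the degree
  \<open>a\<close> component \<open>Z\<^sub>a / B\<^sub>a\<close> of the \<open>i\<close>-th homology is nonzero. By the uniqueness of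
  free resolutions up to homotopy, it makes no difference which resolution is used.
\<close>

definition tor_nonzero :: "nat \<Rightarrow> ('n::finite, 'k::field) mpoly set \<Rightarrow> ('n \<Rightarrow>\<^sub>0 nat) \<Rightarrow> bool"
  where "tor_nonzero i I a \<longleftrightarrow>
    (\<exists>P. free_resolution_of_field P \<and>
      \<not> tensor_cycles P i I \<inter> homogeneous_vecs P i a
          \<subseteq> tensor_boundaries P i I \<inter> homogeneous_vecs P i a)"


section \<open>Homological shift ideals\<close>

definition HS :: "nat \<Rightarrow> ('n::finite, 'k::field) mpoly set \<Rightarrow> ('n, 'k) mpoly set"
  where "HS i I = ideal_gen {xpow a | a. tor_nonzero i I a}"

definition Lin :: "nat \<Rightarrow> ('n::finite, 'k::field) mpoly set \<Rightarrow> ('n, 'k) mpoly set"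
  where "Lin i I = degree_part (HS i I) (gen_degree I + i)"


section \<open>Edge ideals\<close>

text \<open>A simple graph on the vertex set \<open>UNIV :: 'n set\<close> is given by its set of edges.\<close>

definition simple_graph :: "'n set set \<Rightarrow> bool"
  where "simple_graph E \<longleftrightarrow> (\<forall>e\<in>E. card e = 2)"

definition edge_ideal :: "'n set set \<Rightarrow> ('n, 'k::field) mpoly set"
  where "edge_ideal E = ideal_gen {var i * var j | i j. {i, j} \<in> E}"

end

theory Submission
  imports Defs "HOL-Library.Cardinality"
begin

text \<open>
  For a monomial ideal \<open>J\<close> and a multidegree \<open>a\<close> consider the graph on the variables
  \<open>i\<close> with \<open>x\<^sup>a / x\<^sub>i \<in> J\<close> in which \<open>i\<close> and \<open>j\<close> are joined if
  \<open>x\<^sup>a / (x\<^sub>i x\<^sub>j) \<in> J\<close>. The first Tor module of \<open>K\<close> and \<open>J\<close> is nonzero in degree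
  \<open>a\<close> exactly if this shift graph is disconnected. As \<open>tor_nonzero\<close> speaks of some
  resolution of \<open>K\<close>, vanishing has to be proved for all resolutions, which is a chase through
  the first three terms (\<open>cycle_boundary_if_shift_connected\<close>). For non-vanishing one
  resolution suffices, but it has to be exhibited (\<open>tuple_complex_resolution\<close>,
  \<open>tor_nonzero_if_shift_separated\<close>).

  With this criterion the theorem becomes combinatorics. Let \<open>J = I\<^sup>k\<close>, whose generators are
  the products \<open>x\<^sup>U\<close> over multisets \<open>U\<close> of \<open>k\<close> edges.

  If \<open>x\<^sup>U\<close> and \<open>x\<^sup>V\<close> divide \<open>x\<^sup>a\<close> and are different, follow a trail that
  alternates between edges of \<open>V\<close> and edges of \<open>U\<close>, starting at a vertex with larger degree in
  \<open>V\<close> (\<open>alternating_trail\<close>). Exchanging edges along it either changes \<open>x\<^sup>U\<close> in one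
  variable and brings it closer to \<open>x\<^sup>V\<close>, or yields a product of \<open>k + 1\<close> edges dividing
  \<open>x\<^sup>a\<close>, and in that case \<open>x\<^sup>a\<close> is in the non-pure power of exponent \<open>k + 1\<close>
  (\<open>nonpure_or_linear_step\<close>). So outside the non-pure power all generators dividing
  \<open>x\<^sup>a\<close> are connected by linear steps, and unless \<open>a\<close> has the least possible degree
  \<open>2k + 1\<close> this makes the shift graph connected
  (\<open>shift_connected_outside_nonpure\<close>). Hence a multidegree in which Tor does not vanish
  contributes to the linear part or lies in the non-pure power.

  Conversely, a generator of the non-pure power is a multiple of two different generators of
  \<open>I\<^sup>k\<close>. In a minimal multidegree with this property the two generators lie over different
  components of the shift graph (\<open>two_divisors_separated\<close>), so the first Tor module does not
  vanish there.
\<close>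

section \<open>Monomials and monomial ideals\<close>

text \<open>
  Over a commutative ring acting on itself this rule says \<open>a * (b * c) = a * b * c\<close>,
  so as a rewrite rule it loops against \<open>mult.assoc\<close> and \<open>algebra_simps\<close>.
\<close>

declare ring_module.scale_scale [simp del]

abbreviation mono_dvd :: "('n \<Rightarrow>\<^sub>0 nat) \<Rightarrow> ('n \<Rightarrow>\<^sub>0 nat) \<Rightarrow> bool"
  where "mono_dvd a b \<equiv> (\<exists>t. b = a + t)"

lemma mono_dvd_iff_lookup_le:
  "mono_dvd a b \<longleftrightarrow> (\<forall>i. Poly_Mapping.lookup a i \<le> Poly_Mapping.lookup b i)"
proof
  assume "\<forall>i. Poly_Mapping.lookup a i \<le> Poly_Mapping.lookup b i"
  then have "b = a + (b - a)"
    by (intro poly_mapping_eqI) (simp add: lookup_add lookup_minus)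
  then show "mono_dvd a b" ..
qed (auto simp: lookup_add)

lemma mono_dvd_addD: "mono_dvd (u + v) a \<Longrightarrow> mono_dvd u a"
  by (auto simp: add.assoc)

lemma mono_dvd_add_addD: "mono_dvd (u + v + w) a \<Longrightarrow> mono_dvd (u + w) a"
proof -
  assume "mono_dvd (u + v + w) a"
  then obtain t where "a = u + v + w + t" by blast
  then have "a = u + w + (v + t)" by (simp only: ac_simps)
  then show ?thesis by blast
qed

lemma xpow_add: "xpow (a + b) = xpow a * (xpow b :: ('n, 'k::field) mpoly)"
  by (simp add: xpow_def mult_single)

lemma xpow_inject [simp]: "(xpow a :: ('n, 'k::field) mpoly) = xpow b \<longleftrightarrow> a = b"
  unfolding xpow_def by (metis keys_single one_neq_zero singleton_inject)

lemma total_deg_add: "total_deg (a + b) = total_deg a + total_deg b"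
  by (simp add: total_deg_def lookup_add sum.distrib)

lemma total_deg_zero [simp]: "total_deg 0 = 0"
  by (simp add: total_deg_def)

lemma total_deg_single [simp]: "total_deg (Poly_Mapping.single i m) = m"
  by (simp add: total_deg_def lookup_single when_def)

lemma total_deg_eq_0_iff: "total_deg a = 0 \<longleftrightarrow> a = 0"
  by (auto simp: total_deg_def intro!: poly_mapping_eqI)

lemma mpoly_eq_sum_monomials:
  fixes f :: "('n, 'k::field) mpoly"
  shows "f = (\<Sum>m\<in>Poly_Mapping.keys f. Poly_Mapping.single m (Poly_Mapping.lookup f m))"
  by (rule poly_mapping_eqI)
     (auto simp: lookup_sum lookup_single when_def not_in_keys_iff_lookup_eq_zero)

lemma in_monomial_ideal_iff:
  fixes f :: "('n, 'k::field) mpoly"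
  shows "f \<in> ideal_gen (xpow ` A) \<longleftrightarrow> (\<forall>m\<in>Poly_Mapping.keys f. \<exists>a\<in>A. mono_dvd a m)"
proof
  assume "f \<in> ideal_gen (xpow ` A)"
  then show "\<forall>m\<in>Poly_Mapping.keys f. \<exists>a\<in>A. mono_dvd a m"
  proof (induction rule: ring_module.span_induct_alt)
    case base
    then show ?case by simp
  next
    case (step c x y)
    then obtain a where a: "x = xpow a" "a \<in> A" by auto
    show ?case
    proof
      fix m assume "m \<in> Poly_Mapping.keys (c * x + y)"
      then consider "m \<in> Poly_Mapping.keys y" | "m \<in> Poly_Mapping.keys (c * x)"
        using keys_add[of "c * x" y] by blast
      then show "\<exists>a\<in>A. mono_dvd a m"
      proof cases
        case 2
        then obtain u v where "m = u + v" "v \<in> Poly_Mapping.keys x"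
          using keys_mult[of c x] by blast
        then have "m = a + u" using a by (simp add: xpow_def add.commute)
        then show ?thesis using a by blast
      qed (use step in blast)
    qed
  qed
next
  assume *: "\<forall>m\<in>Poly_Mapping.keys f. \<exists>a\<in>A. mono_dvd a m"
  have "(\<Sum>m\<in>Poly_Mapping.keys f. Poly_Mapping.single m (Poly_Mapping.lookup f m))
          \<in> ideal_gen (xpow ` A)"
  proof (rule ring_module.span_sum)
    fix m assume "m \<in> Poly_Mapping.keys f"
    with * obtain a t where a: "a \<in> A" "m = a + t" by blast
    have "Poly_Mapping.single m (Poly_Mapping.lookup f m)
        = Poly_Mapping.single t (Poly_Mapping.lookup f m) * xpow a"
      by (simp add: xpow_def mult_single a add.commute)
    then show "Poly_Mapping.single m (Poly_Mapping.lookup f m) \<in> ideal_gen (xpow ` A)"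
      using a by (simp add: ring_module.span_scale ring_module.span_base)
  qed
  then show "f \<in> ideal_gen (xpow ` A)" using mpoly_eq_sum_monomials[of f] by simp
qed

lemma xpow_in_monomial_ideal_iff:
  "(xpow m :: ('n, 'k::field) mpoly) \<in> ideal_gen (xpow ` A) \<longleftrightarrow> (\<exists>a\<in>A. mono_dvd a m)"
  unfolding in_monomial_ideal_iff by (simp add: xpow_def)

lemma ideal_gen_eqI:
  assumes "A \<subseteq> ideal_gen B" "B \<subseteq> ideal_gen A"
  shows "ideal_gen A = ideal_gen B"
  using assms by (metis ring_module.span_minimal ring_module.subspace_span subset_antisym)

lemma ideal_prod_gen:
  fixes A B :: "'a::comm_ring_1 set"
  shows "ideal_prod (ideal_gen A) (ideal_gen B) = ideal_gen {a * b | a b. a \<in> A \<and> b \<in> B}"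
    (is "_ = ideal_gen ?AB")
  unfolding ideal_prod_def
proof (rule ideal_gen_eqI)
  have "f * g \<in> ideal_gen ?AB" if f: "f \<in> ideal_gen A" and g: "g \<in> ideal_gen B" for f g
    using f
  proof (induction rule: ring_module.span_induct_alt)
    case base
    then show ?case by (simp add: ring_module.span_zero)
  next
    case (step c a f')
    have "a * g \<in> ideal_gen ?AB"
      using g
    proof (induction rule: ring_module.span_induct_alt)
      case base
      then show ?case by (simp add: ring_module.span_zero)
    next
      case (step c' b g')
      have "a * b \<in> ideal_gen ?AB"
        using step(1) \<open>a \<in> A\<close> by (intro ring_module.span_base) auto
      then have "c' * (a * b) + a * g' \<in> ideal_gen ?AB"
        using step(2) by (simp only: ring_module.span_add ring_module.span_scale)
      moreover have "a * (c' * b + g') = c' * (a * b) + a * g'" by (simp add: algebra_simps)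
      ultimately show ?case by simp
    qed
    then have "c * (a * g) + f' * g \<in> ideal_gen ?AB"
      using step(2) by (simp only: ring_module.span_add ring_module.span_scale)
    moreover have "(c * a + f') * g = c * (a * g) + f' * g" by (simp add: algebra_simps)
    ultimately show ?case by simp
  qed
  then show "{f * g |f g. f \<in> ideal_gen A \<and> g \<in> ideal_gen B} \<subseteq> ideal_gen ?AB" by auto
next
  show "?AB \<subseteq> ideal_gen {f * g |f g. f \<in> ideal_gen A \<and> g \<in> ideal_gen B}"
    by (auto intro!: ring_module.span_base)
qed

text \<open>
  Distinct monomials of the same degree do not divide each other, so none of them can be
  omitted. Conversely, if monomials \<open>M\<close> generate the same ideal, a monomial of the given
  set is divisible by one in \<open>M\<close>, which in turn is divisible by one of the given
  set; comparing degrees, all three are equal.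
\<close>

lemma min_mono_gens_equigenerated:
  fixes A :: "('n::finite \<Rightarrow>\<^sub>0 nat) set"
  assumes deg: "\<And>a. a \<in> A \<Longrightarrow> total_deg a = d"
  shows "min_mono_gens (ideal_gen (xpow ` A) :: ('n, 'k::field) mpoly set) = xpow ` A"
    (is "min_mono_gens ?I = ?G")
proof -
  have eq: "a = b" if "a \<in> A" "b \<in> A" "mono_dvd a b" for a b
    using that deg by (metis add_cancel_right_right total_deg_add total_deg_eq_0_iff)
  have min: "M' = ?G" if "M' \<subseteq> ?G" "ideal_gen M' = ?I" for M'
  proof
    obtain B where B: "B \<subseteq> A" "M' = xpow ` B" using \<open>M' \<subseteq> ?G\<close> by (meson subset_imageE)
    show "?G \<subseteq> M'"
    proof
      fix g assume "g \<in> ?G"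
      then obtain a where a: "a \<in> A" "g = xpow a" by auto
      then have "xpow a \<in> ideal_gen M'" using that by (simp add: ring_module.span_base)
      then obtain b where "b \<in> B" "mono_dvd b a" by (auto simp: B xpow_in_monomial_ideal_iff)
      then have "b = a" using eq a(1) B(1) by auto
      then show "g \<in> M'" using \<open>b \<in> B\<close> a(2) B(2) by simp
    qed
  qed (fact that(1))
  have "is_min_mono_gens ?I ?G"
    unfolding is_min_mono_gens_def using min by (auto dest: psubset_imp_subset)
  moreover have "M = ?G" if M: "is_min_mono_gens ?I M" for M
  proof -
    from M obtain B where B: "M = xpow ` B"
      unfolding is_min_mono_gens_def by (metis subset_imageE)
    have span: "ideal_gen M = ?I" using M by (simp add: is_min_mono_gens_def)
    have "?G \<subseteq> M"
    proof
      fix g assume "g \<in> ?G"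
      then obtain a where a: "a \<in> A" "g = xpow a" by auto
      then have "xpow a \<in> ideal_gen M" by (simp add: span ring_module.span_base)
      then obtain b where b: "b \<in> B" "mono_dvd b a" by (auto simp: B xpow_in_monomial_ideal_iff)
      have "xpow b \<in> ?I" unfolding span[symmetric] using b B by (simp add: ring_module.span_base)
      then obtain a' where a': "a' \<in> A" "mono_dvd a' b" by (auto simp: xpow_in_monomial_ideal_iff)
      have "mono_dvd a' a" using a'(2) b(2) by (metis add.assoc)
      then have "a' = a" using eq a(1) a'(1) by simp
      then have "mono_dvd a b" using a' by simp
      then have "a = b" using b(2) unfolding mono_dvd_iff_lookup_le
        by (intro poly_mapping_eqI) (simp add: le_antisym)
      then show "g \<in> M" using b B a by simp
    qed
    then show ?thesis using M unfolding is_min_mono_gens_def by (metis psubsetI)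
  qed
  ultimately show ?thesis unfolding min_mono_gens_def by (intro the_equality)
qed

lemma gen_degree_equigenerated:
  fixes A :: "('n::finite \<Rightarrow>\<^sub>0 nat) set"
  assumes deg: "\<And>a. a \<in> A \<Longrightarrow> total_deg a = d" and "A \<noteq> {}"
  shows "gen_degree (ideal_gen (xpow ` A) :: ('n, 'k::field) mpoly set) = d"
    (is "gen_degree ?I = d")
  unfolding gen_degree_def
proof (rule some_equality)
  show "generated_in_degree d ?I" unfolding generated_in_degree_def using deg by blast
next
  fix d' assume "generated_in_degree d' ?I"
  then obtain B where B: "\<And>b. b \<in> B \<Longrightarrow> total_deg b = d'" "?I = ideal_gen (xpow ` B)"
    unfolding generated_in_degree_def by blast
  obtain a where a: "a \<in> A" using \<open>A \<noteq> {}\<close> by blast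
  then have "(xpow a :: ('n, 'k) mpoly) \<in> ?I" by (simp add: ring_module.span_base)
  then obtain b where b: "b \<in> B" "mono_dvd b a"
    unfolding B(2) by (auto simp: xpow_in_monomial_ideal_iff)
  then have "(xpow b :: ('n, 'k) mpoly) \<in> ?I" unfolding B(2) by (simp add: ring_module.span_base)
  then obtain a' where a': "a' \<in> A" "mono_dvd a' b" by (auto simp: xpow_in_monomial_ideal_iff)
  have "total_deg b \<le> total_deg a" "total_deg a' \<le> total_deg b"
    using b a' by (auto simp: total_deg_add)
  then show "d' = d" using a a' b B(1) deg by force
qed


section \<open>Exponents of products of edges\<close>

text \<open>
  The exponent of the squarefree monomial with support \<open>X\<close>. For an edge it gives the
  corresponding generator of the edge ideal; the same monomials are the multidegrees of the
  basis elements in the resolution constructed below.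
\<close>

definition ind :: "'n set \<Rightarrow> 'n \<Rightarrow>\<^sub>0 nat"
  where "ind X = (\<Sum>i\<in>X. Poly_Mapping.single i 1)"

lemma lookup_ind: "finite X \<Longrightarrow> Poly_Mapping.lookup (ind X) i = (if i \<in> X then 1 else 0)"
  by (simp add: ind_def lookup_sum lookup_single when_def)

lemma total_deg_ind: "total_deg (ind (X :: 'n::finite set)) = card X"
  by (simp add: total_deg_def lookup_ind flip: sum.inter_filter)

lemma ind_inject: "ind (X :: 'n::finite set) = ind Y \<longleftrightarrow> X = Y"
  by (metis finite lookup_ind one_neq_zero set_eqI)

lemma ind_doubleton: "i \<noteq> j \<Longrightarrow> ind {i, j} = Poly_Mapping.single i 1 + Poly_Mapping.single j 1"
  by (simp add: ind_def)

text \<open>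
  For a multiset of edges, regarded as a multigraph, the entry at a vertex is its degree.
\<close>

definition edges_exp :: "'n set multiset \<Rightarrow> 'n \<Rightarrow>\<^sub>0 nat"
  where "edges_exp U = (\<Sum>e\<in>#U. ind e)"

lemma edges_exp_empty [simp]: "edges_exp {#} = 0"
  and edges_exp_add_mset [simp]: "edges_exp (add_mset e U) = ind e + edges_exp U"
  by (simp_all add: edges_exp_def)

lemma total_deg_edges_exp:
  fixes U :: "'n::finite set multiset"
  assumes "\<forall>e\<in>#U. card e = 2"
  shows "total_deg (edges_exp U) = 2 * size U"
  using assms by (induction U) (simp_all add: total_deg_add total_deg_ind)

lemma vertex_of_edges_exp:
  fixes U :: "'n::finite set multiset"
  assumes "Poly_Mapping.lookup (edges_exp U) i > 0"
  shows "\<exists>e\<in>#U. i \<in> e"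
  using assms by (induction U) (auto simp: lookup_add lookup_ind split: if_splits)

lemma edge_at_vertex:
  fixes U :: "'n::finite set multiset"
  assumes "Poly_Mapping.lookup (edges_exp U) i > 0" and simple: "\<forall>e\<in>#U. card e = 2"
  obtains j U' where "U = add_mset {i, j} U'" "i \<noteq> j"
proof -
  obtain e where e: "e \<in># U" "i \<in> e" using vertex_of_edges_exp assms(1) by blast
  with simple obtain x y where "e = {x, y}" "x \<noteq> y" by (auto simp: card_2_iff)
  with e(2) obtain j where "e = {i, j}" "i \<noteq> j" by auto
  then show ?thesis using that e(1) by (metis insert_DiffM)
qed


section \<open>Exchanging edges along alternating trails\<close>

text \<open>
  Call a vertex a \<open>V\<close>-excess vertex if it has larger degree in \<open>V\<close> than in
  \<open>U\<close>. From the \<open>V\<close>-excess vertex \<open>q\<close> leave along an edge of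
  \<open>V\<close>, continue along an edge of \<open>U\<close>, and so on, never using an edge twice. The
  trail can be continued until, after an edge of \<open>U\<close>, it stands at a
  \<open>U\<close>-excess vertex \<open>p\<close>, or, after an edge of \<open>V\<close>, at a
  \<open>V\<close>-excess vertex \<open>p\<close>. Exchanging in \<open>U\<close> the edges of
  \<open>U\<close> on the trail for those of \<open>V\<close> changes degrees only at the two ends.
  In the first case a linear step towards \<open>V\<close> results; in the second case the trail is
  augmenting and produces one edge more. If the trail closes up at \<open>p = q\<close>, the excess
  there is at least two. The induction removes the first two edges of the trail.
\<close>

lemma alternating_trail:
  fixes U V :: "'n::finite set multiset"
  assumes "\<forall>e\<in>#U. card e = 2" "\<forall>e\<in>#V. card e = 2"
    and "Poly_Mapping.lookup (edges_exp U) q < Poly_Mapping.lookup (edges_exp V) q"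
  shows "(\<exists>p U'. set_mset U' \<subseteq> set_mset U \<union> set_mset V \<and> size U' = size U
            \<and> Poly_Mapping.lookup (edges_exp V) p < Poly_Mapping.lookup (edges_exp U) p
            \<and> edges_exp U' + Poly_Mapping.single p 1 = edges_exp U + Poly_Mapping.single q 1)
       \<or> (\<exists>p U'. set_mset U' \<subseteq> set_mset U \<union> set_mset V \<and> size U' = Suc (size U)
            \<and> edges_exp U' = edges_exp U + Poly_Mapping.single q 1 + Poly_Mapping.single p 1
            \<and> Poly_Mapping.lookup (edges_exp U) p + 1 + (if p = q then 1 else 0)
                \<le> Poly_Mapping.lookup (edges_exp V) p)"
  using assms
proof (induction "size U" arbitrary: U V q)
  case (0 U V q)
  obtain r V1 where V: "V = add_mset {q, r} V1" "q \<noteq> r"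
    by (rule edge_at_vertex[of V q]) (use 0 in auto)
  have "Poly_Mapping.lookup (edges_exp V) r > 0" using V by (simp add: lookup_add lookup_ind)
  then show ?case using 0 V
    by (intro disjI2 exI[of _ r] exI[of _ "{#{q, r}#}"]) (auto simp: ind_doubleton)
next
  case (Suc n U V q)
  obtain r V1 where V: "V = add_mset {q, r} V1" "q \<noteq> r"
    by (rule edge_at_vertex[of V q]) (use Suc.prems in auto)
  show ?case
  proof (cases "Poly_Mapping.lookup (edges_exp U) r < Poly_Mapping.lookup (edges_exp V) r")
    case True
    then show ?thesis using V
      by (intro disjI2 exI[of _ r] exI[of _ "add_mset {q, r} U"])
         (auto simp: ind_doubleton algebra_simps)
  next
    case False
    have "Poly_Mapping.lookup (edges_exp V) r > 0" using V by (simp add: lookup_add lookup_ind)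
    with False have r: "Poly_Mapping.lookup (edges_exp U) r > 0" by simp
    obtain s U1 where U: "U = add_mset {r, s} U1" "r \<noteq> s"
      by (rule edge_at_vertex[of U r]) (use r Suc.prems(1) in auto)
    have exps: "edges_exp U = edges_exp U1 + Poly_Mapping.single r 1 + Poly_Mapping.single s 1"
      "edges_exp V = edges_exp V1 + Poly_Mapping.single q 1 + Poly_Mapping.single r 1"
      using U V by (simp_all add: ind_doubleton algebra_simps)
    note lk = exps[THEN arg_cong[where f = Poly_Mapping.lookup], THEN fun_cong,
        unfolded lookup_add lookup_single when_def]
    show ?thesis
    proof (cases "Poly_Mapping.lookup (edges_exp U1) s < Poly_Mapping.lookup (edges_exp V1) s")
      case False
      then have "Poly_Mapping.lookup (edges_exp V) s < Poly_Mapping.lookup (edges_exp U) s"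
        using Suc.prems(3) U(2) V(2) by (auto simp: lk split: if_splits)
      then show ?thesis using U V exps
        by (intro disjI1 exI[of _ s] exI[of _ "add_mset {q, r} U1"])
           (auto simp: ind_doubleton algebra_simps)
    next
      case True
      have "n = size U1" "\<forall>e\<in>#U1. card e = 2" "\<forall>e\<in>#V1. card e = 2"
        using Suc.hyps(2) Suc.prems U V by auto
      from Suc.hyps(1)[OF this True] show ?thesis
      proof (elim disjE exE conjE)
        fix p U' assume U': "set_mset U' \<subseteq> set_mset U1 \<union> set_mset V1" "size U' = size U1"
          "Poly_Mapping.lookup (edges_exp V1) p < Poly_Mapping.lookup (edges_exp U1) p"
          "edges_exp U' + Poly_Mapping.single p 1 = edges_exp U1 + Poly_Mapping.single s 1"
        have "Poly_Mapping.lookup (edges_exp V) p < Poly_Mapping.lookup (edges_exp U) p"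
          using U'(3) Suc.prems(3) U(2) V(2) by (auto simp: lk split: if_splits)
        moreover have "edges_exp (add_mset {q, r} U') + Poly_Mapping.single p 1
            = edges_exp U + Poly_Mapping.single q 1"
          using arg_cong[OF U'(4), of "\<lambda>x. x + ind {q, r}"] V
          by (simp add: ind_doubleton exps algebra_simps)
        ultimately show ?thesis using U V U'(1,2)
          by (intro disjI1 exI[of _ p] exI[of _ "add_mset {q, r} U'"]) auto
      next
        fix p U' assume U': "set_mset U' \<subseteq> set_mset U1 \<union> set_mset V1" "size U' = Suc (size U1)"
          "edges_exp U' = edges_exp U1 + Poly_Mapping.single s 1 + Poly_Mapping.single p 1"
          "Poly_Mapping.lookup (edges_exp U1) p + 1 + (if p = s then 1 else 0)
            \<le> Poly_Mapping.lookup (edges_exp V1) p"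
        have "Poly_Mapping.lookup (edges_exp U) p + 1 + (if p = q then 1 else 0)
            \<le> Poly_Mapping.lookup (edges_exp V) p"
          using U'(4) Suc.prems(3) U(2) V(2) by (auto simp: lk split: if_splits)
        moreover have "edges_exp (add_mset {q, r} U')
            = edges_exp U + Poly_Mapping.single q 1 + Poly_Mapping.single p 1"
          using V by (simp add: U'(3) ind_doubleton exps algebra_simps)
        ultimately show ?thesis using U V U'(1,2)
          by (intro disjI2 exI[of _ p] exI[of _ "add_mset {q, r} U'"]) auto
      qed
    qed
  qed
qed


section \<open>Ordinary and non-pure powers of an edge ideal\<close>

definition pow_exps :: "'n set set \<Rightarrow> nat \<Rightarrow> ('n \<Rightarrow>\<^sub>0 nat) set"
  where "pow_exps E k = edges_exp ` {U. set_mset U \<subseteq> E \<and> size U = k}"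

definition nonpure_exps :: "'n set set \<Rightarrow> nat \<Rightarrow> ('n \<Rightarrow>\<^sub>0 nat) set"
  where "nonpure_exps E k = edges_exp ` {U. set_mset U \<subseteq> E \<and> size U = k \<and> card (set_mset U) > 1}"

lemma total_deg_pow_exps:
  fixes E :: "'n::finite set set"
  assumes "simple_graph E" "a \<in> pow_exps E k"
  shows "total_deg a = 2 * k"
  using assms unfolding pow_exps_def simple_graph_def
  by (auto intro: total_deg_edges_exp[THEN trans])

lemma edge_ideal_eq:
  fixes E :: "'n::finite set set"
  assumes "simple_graph E"
  shows "edge_ideal E = (ideal_gen (xpow ` ind ` E) :: ('n, 'k::field) mpoly set)"
proof -
  have "{var i * var j | i j. {i, j} \<in> E} = (xpow ` ind ` E :: ('n, 'k) mpoly set)" (is "?L = ?R")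
  proof (intro set_eqI iffI)
    fix f :: "('n, 'k) mpoly" assume "f \<in> ?L"
    then obtain i j where ij: "{i, j} \<in> E" "f = var i * var j" by blast
    then have "i \<noteq> j" using assms by (force simp: simple_graph_def)
    then have "f = xpow (ind {i, j})" by (simp add: ij var_def xpow_add ind_doubleton)
    then show "f \<in> ?R" using ij by blast
  next
    fix f :: "('n, 'k) mpoly" assume "f \<in> ?R"
    then obtain e where e: "e \<in> E" "f = xpow (ind e)" by blast
    then obtain i j where ij: "e = {i, j}" "i \<noteq> j"
      using assms by (auto simp: simple_graph_def card_2_iff)
    then have "f = var i * var j" by (simp add: e var_def xpow_add ind_doubleton)
    then show "f \<in> ?L" using e ij by blast
  qed
  then show ?thesis by (simp add: edge_ideal_def)
qed

lemma edge_ideal_pow_eq: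
  fixes E :: "'n::finite set set"
  assumes "simple_graph E"
  shows "ideal_pow (edge_ideal E) k = (ideal_gen (xpow ` pow_exps E k) :: ('n, 'k::field) mpoly set)"
proof (induction k)
  case 0
  have "pow_exps E 0 = {0}" by (auto simp: pow_exps_def intro!: image_eqI[of _ _ "{#}"])
  then have "f \<in> ideal_gen (xpow ` pow_exps E 0)" for f :: "('n, 'k) mpoly"
    unfolding in_monomial_ideal_iff by simp
  then show ?case by auto
next
  case (Suc k)
  have "{f * g | f g. f \<in> xpow ` ind ` E \<and> g \<in> xpow ` pow_exps E k}
      = (xpow ` pow_exps E (Suc k) :: ('n, 'k) mpoly set)" (is "?L = ?R")
  proof (intro set_eqI iffI)
    fix f :: "('n, 'k) mpoly" assume "f \<in> ?L"
    then obtain e U where *: "e \<in> E" "set_mset U \<subseteq> E" "size U = k"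
        "f = xpow (ind e) * xpow (edges_exp U)"
      unfolding pow_exps_def by auto
    then have "f = xpow (edges_exp (add_mset e U))" by (simp add: xpow_add)
    moreover have "edges_exp (add_mset e U) \<in> pow_exps E (Suc k)"
      unfolding pow_exps_def using * by (intro imageI CollectI) auto
    ultimately show "f \<in> ?R" by blast
  next
    fix f :: "('n, 'k) mpoly" assume "f \<in> ?R"
    then obtain U where U: "set_mset U \<subseteq> E" "size U = Suc k" "f = xpow (edges_exp U)"
      unfolding pow_exps_def by auto
    then obtain e U' where "U = add_mset e U'" by (metis size_eq_Suc_imp_eq_union)
    with U have "f = xpow (ind e) * xpow (edges_exp U')" "e \<in> E" "edges_exp U' \<in> pow_exps E k"
      by (auto simp: xpow_add pow_exps_def)
    then show "f \<in> ?L" by blast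
  qed
  then show ?case by (simp add: edge_ideal_eq[OF assms] Suc[unfolded edge_ideal_eq[OF assms]] ideal_prod_gen)
qed

lemma prod_mset_xpow: "(\<Prod>e\<in>#U. xpow (ind e)) = (xpow (edges_exp U) :: ('n, 'k::field) mpoly)"
proof (induction U)
  case empty
  then show ?case by (simp add: xpow_def)
qed (simp add: xpow_add)

text \<open>
  The map from edges to generators is injective, so a multiset of generators is pure exactly
  if the corresponding multiset of edges is. For \<open>k = 1\<close> the non-pure power is by
  convention the ideal itself, which this formula does not give.
\<close>

lemma nonpure_power_edge_ideal_eq:
  fixes E :: "'n::finite set set"
  assumes "simple_graph E" "k \<noteq> 1"
  shows "nonpure_power (edge_ideal E) k = (ideal_gen (xpow ` nonpure_exps E k) :: ('n, 'k::field) mpoly set)"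
proof -
  let ?g = "\<lambda>e. xpow (ind e) :: ('n, 'k) mpoly"
  have inj: "inj ?g" by (auto intro!: injI simp: ind_inject)
  have gens: "min_mono_gens (edge_ideal E) = ?g ` E"
    unfolding edge_ideal_eq[OF assms(1)]
    by (subst min_mono_gens_equigenerated[where d = 2])
       (use assms(1) in \<open>auto simp: simple_graph_def total_deg_ind image_image\<close>)
  have "{prod_mset W | W. set_mset W \<subseteq> ?g ` E \<and> size W = k \<and> card (set_mset W) > 1}
      = xpow ` nonpure_exps E k" (is "?L = ?R")
  proof (intro set_eqI iffI)
    fix f assume "f \<in> ?L"
    then obtain W where W: "f = prod_mset W" "set_mset W \<subseteq> ?g ` E" "size W = k" "card (set_mset W) > 1"
      by blast
    define U where "U = image_mset (inv ?g) W"
    have "?g (inv ?g x) = x" if "x \<in># W" for x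
      using W(2) that by (intro f_inv_into_f) auto
    then have "image_mset (?g \<circ> inv ?g) W = image_mset (\<lambda>x. x) W"
      by (intro image_mset_cong) simp
    then have WU: "W = image_mset ?g U"
      by (simp add: U_def image_mset.compositionality)
    have "set_mset U \<subseteq> E" using W(2) by (force simp: U_def inv_f_f[OF inj])
    moreover have "card (set_mset U) > 1" using W(4)
      by (simp add: WU card_image[OF inj_on_subset[OF inj subset_UNIV]])
    ultimately show "f \<in> ?R" using W(1,3)
      by (auto simp: WU prod_mset_xpow nonpure_exps_def)
  next
    fix f assume "f \<in> ?R"
    then obtain U where U: "set_mset U \<subseteq> E" "size U = k" "card (set_mset U) > 1" "f = xpow (edges_exp U)"
      unfolding nonpure_exps_def by auto
    then show "f \<in> ?L"
      by (intro CollectI exI[of _ "image_mset ?g U"])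
         (auto simp: prod_mset_xpow card_image[OF inj_on_subset[OF inj subset_UNIV]])
  qed
  then show ?thesis using assms(2) by (simp add: nonpure_power_def gens)
qed


section \<open>The shift graph of a multidegree\<close>

text \<open>
  For a monomial ideal \<open>J\<close>, \<open>shift_vertex\<close> and \<open>shift_edge\<close> are the
  vertices and edges of the upper Koszul simplicial complex of \<open>J\<close> in degree
  \<open>a\<close>, whose reduced homology in dimension 0 is isomorphic to the degree
  \<open>a\<close> component of the first Tor module. Pairs \<open>i = j\<close> with \<open>x\<^sub>i\<^sup>2\<close> in place of
  \<open>x\<^sub>i x\<^sub>j\<close> are loops, which do not affect connectedness.
\<close>

definition shift_vertex :: "('n, 'k::field) mpoly set \<Rightarrow> ('n \<Rightarrow>\<^sub>0 nat) \<Rightarrow> 'n \<Rightarrow> bool"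
  where "shift_vertex J a i \<longleftrightarrow> (\<exists>m. a = m + Poly_Mapping.single i 1 \<and> xpow m \<in> J)"

definition shift_edge :: "('n, 'k::field) mpoly set \<Rightarrow> ('n \<Rightarrow>\<^sub>0 nat) \<Rightarrow> 'n \<Rightarrow> 'n \<Rightarrow> bool"
  where "shift_edge J a i j \<longleftrightarrow>
    (\<exists>m. a = m + Poly_Mapping.single i 1 + Poly_Mapping.single j 1 \<and> xpow m \<in> J)"

lemma shift_vertex_monomial_ideal_iff:
  "shift_vertex (ideal_gen (xpow ` A) :: ('n, 'k::field) mpoly set) a i
    \<longleftrightarrow> (\<exists>u\<in>A. mono_dvd (u + Poly_Mapping.single i 1) a)"
proof -
  have "u + t + s = u + s + t" for u t s :: "'n \<Rightarrow>\<^sub>0 nat" by (simp only: ac_simps)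
  then show ?thesis unfolding shift_vertex_def xpow_in_monomial_ideal_iff by auto
qed

lemma shift_edge_monomial_ideal_iff:
  "shift_edge (ideal_gen (xpow ` A) :: ('n, 'k::field) mpoly set) a i j
    \<longleftrightarrow> (\<exists>u\<in>A. mono_dvd (u + Poly_Mapping.single i 1 + Poly_Mapping.single j 1) a)"
proof -
  have "u + t + s + r = u + s + r + t" for u t s r :: "'n \<Rightarrow>\<^sub>0 nat" by (simp only: ac_simps)
  then show ?thesis unfolding shift_edge_def xpow_in_monomial_ideal_iff by auto
qed

lemma proper_multiple_shift:
  fixes u a :: "'n::finite \<Rightarrow>\<^sub>0 nat"
  assumes "mono_dvd u a" "u \<noteq> a"
  obtains i where "mono_dvd (u + Poly_Mapping.single i 1) a"
proof -
  have le: "Poly_Mapping.lookup u i \<le> Poly_Mapping.lookup a i" for i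
    using assms(1) by (simp add: mono_dvd_iff_lookup_le)
  obtain i where "Poly_Mapping.lookup u i \<noteq> Poly_Mapping.lookup a i"
    using assms(2) by (metis poly_mapping_eqI)
  with le[of i] have "Poly_Mapping.lookup u i < Poly_Mapping.lookup a i" by simp
  then have "mono_dvd (u + Poly_Mapping.single i 1) a"
    unfolding mono_dvd_iff_lookup_le using le by (auto simp: lookup_add lookup_single when_def)
  then show ?thesis using that by blast
qed

lemma lookup_edges_exp_replicate_mset:
  "finite e \<Longrightarrow> Poly_Mapping.lookup (edges_exp (replicate_mset k e)) i = (if i \<in> e then k else 0)"
  by (induction k) (auto simp: lookup_add lookup_ind)

text \<open>
  Both outcomes of the exchange are monomials dividing the least common multiple of
  \<open>x\<^sup>U\<close> and \<open>x\<^sup>V\<close>, hence \<open>x\<^sup>a\<close>. An augmented product of \<open>k + 1\<close>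
  edges could be a pure power of an edge \<open>e\<close>. Then \<open>V\<close> does not consist of \<open>k\<close>
  copies of \<open>e\<close>, and replacing one factor \<open>e\<close> by an edge \<open>f \<noteq> e\<close> of
  \<open>V\<close> gives a non-pure product; it still divides \<open>x\<^sup>a\<close>: at
  the vertices of \<open>e\<close> because \<open>e\<^sup>k\<^sup>+\<^sup>1\<close> does, and at the others because
  \<open>f\<close> divides \<open>x\<^sup>V\<close>.
\<close>

lemma nonpure_or_linear_step:
  fixes E :: "'n::finite set set"
  assumes E: "simple_graph E" and "k \<ge> 1"
    and U: "set_mset U \<subseteq> E" "size U = k" "mono_dvd (edges_exp U) a"
    and V: "set_mset V \<subseteq> E" "size V = k" "mono_dvd (edges_exp V) a"
    and q: "Poly_Mapping.lookup (edges_exp U) q < Poly_Mapping.lookup (edges_exp V) q"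
  shows "(\<exists>w\<in>nonpure_exps E (k + 1). mono_dvd w a)
    \<or> (\<exists>p U'. set_mset U' \<subseteq> E \<and> size U' = k
            \<and> Poly_Mapping.lookup (edges_exp V) p < Poly_Mapping.lookup (edges_exp U) p
            \<and> edges_exp U' + Poly_Mapping.single p 1 = edges_exp U + Poly_Mapping.single q 1)"
proof -
  have simple: "\<forall>e\<in>#U. card e = 2" "\<forall>e\<in>#V. card e = 2"
    using E U(1) V(1) by (auto simp: simple_graph_def)
  have ule: "Poly_Mapping.lookup (edges_exp U) i \<le> Poly_Mapping.lookup a i"
    and vle: "Poly_Mapping.lookup (edges_exp V) i \<le> Poly_Mapping.lookup a i" for i
    using U(3) V(3) by (simp_all add: mono_dvd_iff_lookup_le)
  from alternating_trail[OF simple q] show ?thesis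
  proof (elim disjE exE conjE)
    fix p U'
    assume "set_mset U' \<subseteq> set_mset U \<union> set_mset V" "size U' = size U"
      "Poly_Mapping.lookup (edges_exp V) p < Poly_Mapping.lookup (edges_exp U) p"
      "edges_exp U' + Poly_Mapping.single p 1 = edges_exp U + Poly_Mapping.single q 1"
    then show ?thesis using U V by (intro disjI2 exI[of _ p] exI[of _ U']) auto
  next
    fix p U'
    assume sub: "set_mset U' \<subseteq> set_mset U \<union> set_mset V" and size: "size U' = Suc (size U)"
      and exp: "edges_exp U' = edges_exp U + Poly_Mapping.single q 1 + Poly_Mapping.single p 1"
      and p: "Poly_Mapping.lookup (edges_exp U) p + 1 + (if p = q then 1 else 0)
                \<le> Poly_Mapping.lookup (edges_exp V) p"
    have U'le: "Poly_Mapping.lookup (edges_exp U') i \<le> Poly_Mapping.lookup a i" for i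
      using p q ule[of i] vle[of i] by (auto simp: exp lookup_add lookup_single when_def split: if_splits)
    have "\<exists>w\<in>nonpure_exps E (k + 1). mono_dvd w a"
    proof (cases "card (set_mset U') > 1")
      case True
      then have "edges_exp U' \<in> nonpure_exps E (k + 1)"
        using sub size U V by (auto simp: nonpure_exps_def)
      then show ?thesis using U'le by (auto simp only: mono_dvd_iff_lookup_le)
    next
      case False
      then have "card (set_mset U') \<le> 1" by simp
      moreover have "set_mset U' \<noteq> {}" using size by auto
      ultimately obtain e where e: "set_mset U' = {e}"
        by (metis card_1_singletonE card_gt_0_iff finite_set_mset le_antisym less_eq_Suc_le One_nat_def)
      then have U': "U' = replicate_mset (k + 1) e"
        using size U(2) by (metis Suc_eq_plus1 set_mset_subset_singletonD subset_refl)
      have "e \<in> E" using e sub U V by auto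
      \<comment> \<open>The exchange raises the degree at \<open>q\<close> to \<open>k + 1\<close> but not above the degree of
        \<open>V\<close> there, which would be \<open>k\<close> if \<open>V\<close> consisted of copies of \<open>e\<close>.\<close>
      have "q \<in> e"
        using arg_cong[OF exp, of "\<lambda>f. Poly_Mapping.lookup f q"]
        by (auto simp: U' lookup_edges_exp_replicate_mset lookup_add simp del: replicate_mset_Suc split: if_splits)
      then have uq: "Poly_Mapping.lookup (edges_exp U) q + 1 + (if p = q then 1 else 0) = k + 1"
        using arg_cong[OF exp, of "\<lambda>f. Poly_Mapping.lookup f q"]
        by (auto simp: U' lookup_edges_exp_replicate_mset lookup_add lookup_single when_def simp del: replicate_mset_Suc split: if_splits)
      have "V \<noteq> replicate_mset k e"
      proof
        assume "V = replicate_mset k e"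
        then have "Poly_Mapping.lookup (edges_exp V) q = k"
          using \<open>q \<in> e\<close> by (simp add: lookup_edges_exp_replicate_mset)
        then show False using uq p q by (auto split: if_splits)
      qed
      then obtain f where f: "f \<in># V" "f \<noteq> e"
        using V(2) by (metis set_mset_subset_singletonD subsetI singletonI)
      then have fle: "Poly_Mapping.lookup (ind f) i \<le> Poly_Mapping.lookup a i" for i
        using vle[of i] by (auto dest!: multi_member_split simp: lookup_add)
      let ?W = "add_mset f (replicate_mset k e)"
      have "set_mset ?W = {f, e}" using \<open>k \<ge> 1\<close> by auto
      then have "edges_exp ?W \<in> nonpure_exps E (k + 1)"
        using f V(1) \<open>e \<in> E\<close> unfolding nonpure_exps_def
        by (intro imageI CollectI) (auto simp: subset_iff)
      moreover have "Poly_Mapping.lookup (edges_exp ?W) i \<le> Poly_Mapping.lookup a i" for i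
        using fle[of i] U'le[of i]
        by (auto simp: U' lookup_edges_exp_replicate_mset lookup_add lookup_ind simp del: replicate_mset_Suc split: if_splits)
      ultimately show ?thesis by (auto simp only: mono_dvd_iff_lookup_le)
    qed
    then show ?thesis ..
  qed
qed

text \<open>
  Two vertices are connected if one generator divides both shifted monomials. By linear
  steps, a generator below the first vertex is moved to one below the second; each step
  decreases the total excess of the target. The least common multiple of two consecutive
  generators has degree \<open>2 * k + 1\<close>, so by the degree assumption both of them divide
  \<open>x\<^sup>a / x\<^sub>l\<close> for some \<open>l\<close>. This vertex is connected to the first one by the old
  generator and to the target by induction, starting from the new generator.
\<close>

lemma shift_connected_outside_nonpure:
  fixes E :: "'n::finite set set" and J :: "('n, 'k::field) mpoly set"
  assumes E: "simple_graph E" and "k \<ge> 1" and J: "J = ideal_gen (xpow ` pow_exps E k)"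
    and nonpure: "\<not> (\<exists>w\<in>nonpure_exps E (k + 1). mono_dvd w a)"
    and deg: "total_deg a > 2 * k + 1"
    and ij: "shift_vertex J a i" "shift_vertex J a j"
  shows "(shift_edge J a)\<^sup>*\<^sup>* i j"
proof -
  have common: "(shift_edge J a)\<^sup>*\<^sup>* i j"
    if "u \<in> pow_exps E k" "mono_dvd (u + Poly_Mapping.single i 1) a"
      "mono_dvd (u + Poly_Mapping.single j 1) a" for u i j
  proof (cases "i = j")
    case False
    have "Poly_Mapping.lookup (u + Poly_Mapping.single i 1 + Poly_Mapping.single j 1) r
        \<le> Poly_Mapping.lookup a r" for r
      using that(2,3)[unfolded mono_dvd_iff_lookup_le, THEN spec, of r] False
      by (auto simp: lookup_add lookup_single when_def split: if_splits)
    then have "shift_edge J a i j"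
      unfolding J shift_edge_monomial_ideal_iff mono_dvd_iff_lookup_le using that(1) by blast
    then show ?thesis by (rule r_into_rtranclp)
  qed simp
  obtain V where V: "set_mset V \<subseteq> E" "size V = k" "mono_dvd (edges_exp V + Poly_Mapping.single j 1) a"
    using ij(2) unfolding J shift_vertex_monomial_ideal_iff pow_exps_def by auto
  from mono_dvd_addD[OF V(3)] have Va: "mono_dvd (edges_exp V) a" .
  have "(shift_edge J a)\<^sup>*\<^sup>* i j"
    if "set_mset U \<subseteq> E" "size U = k" "mono_dvd (edges_exp U + Poly_Mapping.single i 1) a" for U i
    using that
  proof (induction "\<Sum>q\<in>UNIV. Poly_Mapping.lookup (edges_exp V) q - Poly_Mapping.lookup (edges_exp U) q"
      arbitrary: U i rule: less_induct)
    case (less U i)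
    have simple: "\<forall>e\<in>#U. card e = 2" "\<forall>e\<in>#V. card e = 2"
      using E less.prems(1) V(1) by (auto simp: simple_graph_def)
    from mono_dvd_addD[OF less.prems(3)] have Ua: "mono_dvd (edges_exp U) a" .
    have u: "edges_exp U \<in> pow_exps E k" using less.prems by (auto simp: pow_exps_def)
    show ?case
    proof (cases "\<exists>q. Poly_Mapping.lookup (edges_exp U) q < Poly_Mapping.lookup (edges_exp V) q")
      case False
      then have "mono_dvd (edges_exp V) (edges_exp U)" by (simp add: mono_dvd_iff_lookup_le not_less)
      then obtain t where t: "edges_exp U = edges_exp V + t" by blast
      have "total_deg (edges_exp U) = total_deg (edges_exp V)"
        using simple less.prems(2) V(2) by (simp add: total_deg_edges_exp)
      then have "edges_exp U = edges_exp V" using t by (simp add: total_deg_add total_deg_eq_0_iff)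
      then show ?thesis using common[OF u less.prems(3)] V(3) by simp
    next
      case True
      then obtain q where q: "Poly_Mapping.lookup (edges_exp U) q < Poly_Mapping.lookup (edges_exp V) q" ..
      from nonpure_or_linear_step[OF E \<open>k \<ge> 1\<close> less.prems(1,2) Ua V(1,2) Va q] nonpure
      obtain p U' where U': "set_mset U' \<subseteq> E" "size U' = k"
        and p: "Poly_Mapping.lookup (edges_exp V) p < Poly_Mapping.lookup (edges_exp U) p"
        and step: "edges_exp U' + Poly_Mapping.single p 1 = edges_exp U + Poly_Mapping.single q 1"
        by blast
      have "Poly_Mapping.lookup (edges_exp U + Poly_Mapping.single q 1) r
          \<le> Poly_Mapping.lookup a r" for r
        using q Ua[unfolded mono_dvd_iff_lookup_le, THEN spec, of r]
          Va[unfolded mono_dvd_iff_lookup_le, THEN spec, of r]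
        by (auto simp: lookup_add lookup_single when_def)
      then have "mono_dvd (edges_exp U + Poly_Mapping.single q 1) a"
        unfolding mono_dvd_iff_lookup_le by blast
      moreover have "edges_exp U + Poly_Mapping.single q 1 \<noteq> a"
        using deg simple(1) less.prems(2) by (auto simp: total_deg_add total_deg_edges_exp)
      ultimately obtain l where l: "mono_dvd (edges_exp U + Poly_Mapping.single q 1 + Poly_Mapping.single l 1) a"
        by (rule proper_multiple_shift)
      then have "mono_dvd (edges_exp U + Poly_Mapping.single l 1) a" by (rule mono_dvd_add_addD)
      then have "(shift_edge J a)\<^sup>*\<^sup>* i l" using common[OF u less.prems(3)] by blast
      moreover have "(shift_edge J a)\<^sup>*\<^sup>* l j"
      proof (rule less.hyps)
        show "mono_dvd (edges_exp U' + Poly_Mapping.single l 1) a"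
          using l unfolding step[symmetric] by (rule mono_dvd_add_addD)
        have lk: "Poly_Mapping.lookup (edges_exp U') r + (if r = p then 1 else 0)
            = Poly_Mapping.lookup (edges_exp U) r + (if r = q then 1 else 0)" for r
          using arg_cong[OF step, of "\<lambda>f. Poly_Mapping.lookup f r"]
          by (auto simp: lookup_add lookup_single when_def)
        have "Poly_Mapping.lookup (edges_exp V) r - Poly_Mapping.lookup (edges_exp U') r
            \<le> Poly_Mapping.lookup (edges_exp V) r - Poly_Mapping.lookup (edges_exp U) r" for r
          using lk[of r] p by (auto split: if_splits)
        moreover have "Poly_Mapping.lookup (edges_exp V) q - Poly_Mapping.lookup (edges_exp U') q
            < Poly_Mapping.lookup (edges_exp V) q - Poly_Mapping.lookup (edges_exp U) q"
          using lk[of q] p q by (auto split: if_splits)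
        ultimately show "(\<Sum>q\<in>UNIV. Poly_Mapping.lookup (edges_exp V) q - Poly_Mapping.lookup (edges_exp U') q)
          < (\<Sum>q\<in>UNIV. Poly_Mapping.lookup (edges_exp V) q - Poly_Mapping.lookup (edges_exp U) q)"
          by (intro sum_strict_mono_ex1) auto
      qed (use U' in auto)
      ultimately show ?thesis by simp
    qed
  qed
  then show ?thesis using ij(1) unfolding J shift_vertex_monomial_ideal_iff pow_exps_def by blast
qed

text \<open>
  Drop either of two different edges.
\<close>

lemma nonpure_exps_two_divisors:
  fixes E :: "'n::finite set set"
  assumes "w \<in> nonpure_exps E (k + 1)"
  obtains u v where "u \<in> pow_exps E k" "v \<in> pow_exps E k" "u \<noteq> v" "mono_dvd u w" "mono_dvd v w"
proof -
  obtain U where U: "set_mset U \<subseteq> E" "size U = k + 1" "card (set_mset U) > 1" "w = edges_exp U"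
    using assms by (auto simp: nonpure_exps_def)
  then obtain e f where ef: "e \<in># U" "f \<in># U" "e \<noteq> f"
    by (metis card_le_Suc0_iff_eq finite_set_mset not_le One_nat_def)
  have split: "w = ind g + edges_exp (U - {#g#})" "edges_exp (U - {#g#}) \<in> pow_exps E k" if "g \<in># U" for g
  proof -
    have "w = edges_exp (add_mset g (U - {#g#}))" using that U(4) by simp
    then show "w = ind g + edges_exp (U - {#g#})" by (simp only: edges_exp_add_mset)
    show "edges_exp (U - {#g#}) \<in> pow_exps E k"
      unfolding pow_exps_def using that U(1,2)
      by (intro imageI CollectI) (auto simp: size_Diff_singleton dest: in_diffD)
  qed
  show ?thesis
  proof
    show "edges_exp (U - {#e#}) \<noteq> edges_exp (U - {#f#})"
      using split(1)[OF ef(1)] split(1)[OF ef(2)] ef(3) by (metis add_right_cancel ind_inject)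
    show "mono_dvd (edges_exp (U - {#e#})) w" "mono_dvd (edges_exp (U - {#f#})) w"
      using split(1)[OF ef(1)] split(1)[OF ef(2)] by (metis add.commute)+
  qed (use split ef in auto)
qed

text \<open>
  Choose \<open>a\<close> of least degree among the divisors of \<open>w\<close> that are multiples of
  two generators \<open>u \<noteq> v\<close>. Then every proper shift of \<open>a\<close> is a multiple of at
  most one generator, and this generator is the same at both ends of an edge. So the vertices
  whose shift is a multiple of \<open>u\<close> form a union of components, which misses those
  belonging to \<open>v\<close>.
\<close>

lemma two_divisors_separated:
  fixes A :: "('n::finite \<Rightarrow>\<^sub>0 nat) set" and J :: "('n, 'k::field) mpoly set"
  assumes J: "J = ideal_gen (xpow ` A)" and deg: "\<And>a. a \<in> A \<Longrightarrow> total_deg a = d"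
    and uv: "u \<in> A" "v \<in> A" "u \<noteq> v" "mono_dvd u w" "mono_dvd v w"
  obtains a C i j where "mono_dvd a w" "shift_vertex J a i" "shift_vertex J a j"
    "i \<in> C" "j \<notin> C" "\<forall>p q. p \<in> C \<longrightarrow> shift_edge J a p q \<longrightarrow> q \<in> C"
proof -
  let ?P = "\<lambda>a. mono_dvd a w \<and> (\<exists>u v. u \<in> A \<and> v \<in> A \<and> u \<noteq> v \<and> mono_dvd u a \<and> mono_dvd v a)"
  have "?P w" using uv by (auto intro: exI[of _ 0])
  then obtain a where a: "?P a" and least: "\<And>b. ?P b \<Longrightarrow> total_deg a \<le> total_deg b"
    using ex_has_least_nat[of ?P w total_deg] by blast
  obtain u v where uv: "u \<in> A" "v \<in> A" "u \<noteq> v" "mono_dvd u a" "mono_dvd v a" using a by blast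
  have unique: "u = v"
    if A: "u \<in> A" "v \<in> A"
      and ui: "mono_dvd (u + Poly_Mapping.single i 1) a"
      and vi: "mono_dvd (v + Poly_Mapping.single i 1) a"
    for u v i
  proof (rule ccontr)
    assume "u \<noteq> v"
    obtain t where t: "a = u + Poly_Mapping.single i 1 + t" using ui by blast
    define b where "b = u + t"
    have ab: "a = b + Poly_Mapping.single i 1" by (simp add: t b_def algebra_simps)
    have "mono_dvd v b"
      using vi unfolding ab mono_dvd_iff_lookup_le lookup_add by simp
    moreover have "mono_dvd b w" using a mono_dvd_addD unfolding ab by blast
    ultimately have "?P b" using \<open>u \<noteq> v\<close> A b_def by blast
    then show False using least[of b] by (simp add: ab total_deg_add)
  qed
  have proper: "x \<noteq> a" if x: "x \<in> A" and y: "y \<in> A" "x \<noteq> y" "mono_dvd y a" for x y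
  proof
    assume "x = a"
    with y(3) obtain t where t: "x = y + t" by blast
    then have "total_deg t = 0" using deg[OF x] deg[OF y(1)] by (simp add: total_deg_add)
    then show False using t y(2) by (simp add: total_deg_eq_0_iff)
  qed
  obtain i where i: "mono_dvd (u + Poly_Mapping.single i 1) a"
    using proper_multiple_shift[OF uv(4) proper[OF uv(1,2,3,5)]] .
  obtain j where j: "mono_dvd (v + Poly_Mapping.single j 1) a"
    using proper_multiple_shift[OF uv(5) proper[OF uv(2,1) uv(3)[symmetric] uv(4)]] .
  show ?thesis
  proof
    \<comment> \<open>By uniqueness, these are the vertices whose shift has \<open>u\<close> as its only generator.\<close>
    let ?C = "{p. mono_dvd (u + Poly_Mapping.single p 1) a}"
    show "mono_dvd a w" using a by blast
    show "shift_vertex J a i" "shift_vertex J a j"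
      unfolding J shift_vertex_monomial_ideal_iff using i j uv(1,2) by blast+
    show "i \<in> ?C" using i by simp
    show "j \<notin> ?C" using j unique[OF uv(1,2)] uv(3) by blast
    show "\<forall>p q. p \<in> ?C \<longrightarrow> shift_edge J a p q \<longrightarrow> q \<in> ?C"
    proof (intro allI impI)
      fix p q assume p: "p \<in> ?C" and "shift_edge J a p q"
      then obtain x where x: "x \<in> A" "mono_dvd (x + Poly_Mapping.single p 1 + Poly_Mapping.single q 1) a"
        unfolding J shift_edge_monomial_ideal_iff by blast
      from mono_dvd_addD[OF x(2)] mono_dvd_add_addD[OF x(2)]
      have "mono_dvd (x + Poly_Mapping.single p 1) a" "mono_dvd (x + Poly_Mapping.single q 1) a" .
      then show "q \<in> ?C" using unique[OF uv(1) x(1)] p by blast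
    qed
  qed
qed


section \<open>Vanishing of the first Tor module\<close>

lemma differential_diff:
  "differential P i (\<lambda>b. v b - w b) = (\<lambda>c. differential P i v c - differential P i w c)"
  by (auto simp: differential_def left_diff_distrib sum_subtractf)

lemma differential_smult:
  "differential P i (\<lambda>b. f * v b) = (\<lambda>c. f * differential P i v c)"
  by (auto simp: differential_def sum_distrib_left mult.assoc)

lemma differential_sum:
  "differential P i (\<lambda>b. \<Sum>x\<in>X. w x b) = (\<lambda>c. \<Sum>x\<in>X. differential P i (w x) c)"
  by (rule ext) (simp add: differential_def sum_distrib_right sum.swap[of _ X])

lemma lookup_mult_zero:
  fixes f g :: "('n, 'k::field) mpoly"
  shows "Poly_Mapping.lookup (f * g) 0 = Poly_Mapping.lookup f 0 * Poly_Mapping.lookup g 0"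
proof -
  have eq0: "(0 :: 'n \<Rightarrow>\<^sub>0 nat) = q + r \<longleftrightarrow> q = 0 \<and> r = 0" for q r
  proof
    assume "0 = q + r"
    then have "Poly_Mapping.lookup q x + Poly_Mapping.lookup r x = 0" for x
      by (metis lookup_add lookup_zero)
    then show "q = 0 \<and> r = 0" by (auto intro!: poly_mapping_eqI)
  qed simp
  have "Sum_any (\<lambda>q. Poly_Mapping.lookup g q when (0 :: 'n \<Rightarrow>\<^sub>0 nat) = l + q)
      = (Poly_Mapping.lookup g 0 when l = 0)" for l
    by (cases "l = 0") (auto simp: eq0)
  then show ?thesis
    by (simp add: lookup_mult mult_when)
qed

lemma augmentation_diff:
  "augmentation P (\<lambda>b. v b - w b) = augmentation P v - augmentation P w"
  by (simp add: augmentation_def lookup_minus left_diff_distrib sum_subtractf)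

lemma augmentation_smult:
  "augmentation P (\<lambda>b. f * v b) = Poly_Mapping.lookup f 0 * augmentation P v"
  by (simp add: augmentation_def lookup_mult_zero sum_distrib_left mult.assoc)

lemma tensor_boundaries_sum:
  assumes "\<And>x. x \<in> X \<Longrightarrow> w x \<in> tensor_boundaries P i (ideal_gen A)"
  shows "(\<lambda>c. \<Sum>x\<in>X. f x * w x c) \<in> tensor_boundaries P i (ideal_gen A)"
proof -
  have "\<forall>x\<in>X. \<exists>y. y \<in> coord_vecs (ideal_gen A) (rank P (Suc i)) \<and> w x = differential P i y"
    using assms by (auto simp: tensor_boundaries_def)
  then obtain y where y: "\<And>x. x \<in> X \<Longrightarrow> y x \<in> coord_vecs (ideal_gen A) (rank P (Suc i))"
      "\<And>x. x \<in> X \<Longrightarrow> w x = differential P i (y x)"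
    by metis
  have "(\<lambda>c. \<Sum>x\<in>X. f x * w x c) = differential P i (\<lambda>b. \<Sum>x\<in>X. f x * y x b)"
    unfolding differential_sum differential_smult using y(2) by auto
  moreover have "(\<lambda>b. \<Sum>x\<in>X. f x * y x b) \<in> coord_vecs (ideal_gen A) (rank P (Suc i))"
    using y(1) by (auto simp: coord_vecs_def intro!: ring_module.span_sum ring_module.span_scale sum.neutral)
  ultimately show ?thesis unfolding tensor_boundaries_def by blast
qed

lemma tensor_boundaries_add:
  assumes "v \<in> tensor_boundaries P i (ideal_gen A)" "w \<in> tensor_boundaries P i (ideal_gen A)"
  shows "(\<lambda>c. v c + w c) \<in> tensor_boundaries P i (ideal_gen A)"
  using tensor_boundaries_sum[of "{True, False}" "\<lambda>b. if b then v else w" P i A "\<lambda>_. 1"] assms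
  by simp

lemma tensor_boundaries_scaled_boundary:
  assumes "f \<in> ideal_gen A" "y \<in> coord_vecs UNIV (rank P (Suc i))"
  shows "(\<lambda>c. f * differential P i y c) \<in> tensor_boundaries P i (ideal_gen A)"
proof -
  have "y b * f \<in> ideal_gen A" for b using assms(1) by (rule ring_module.span_scale)
  then have "(\<lambda>b. f * y b) \<in> coord_vecs (ideal_gen A) (rank P (Suc i))"
    using assms(2) by (simp add: coord_vecs_def mult.commute[of f])
  then show ?thesis unfolding tensor_boundaries_def differential_smult[symmetric] by blast
qed

lemma homogeneous_mpoly_eq_single:
  fixes f :: "('n, 'k::field) mpoly"
  assumes "\<And>m. m \<in> Poly_Mapping.keys f \<Longrightarrow> m = d"
  shows "f = Poly_Mapping.single d (Poly_Mapping.lookup f d)"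
  using assms by (intro poly_mapping_eqI) (auto simp: lookup_single when_def in_keys_iff)

lemma single_in_ideal_iff:
  fixes c :: "'k::field"
  assumes "c \<noteq> 0"
  shows "Poly_Mapping.single m c \<in> ideal_gen A \<longleftrightarrow> xpow m \<in> ideal_gen A"
proof
  assume "Poly_Mapping.single m c \<in> ideal_gen A"
  then have "Poly_Mapping.single 0 (1 / c) * Poly_Mapping.single m c \<in> ideal_gen A"
    by (rule ring_module.span_scale)
  then show "xpow m \<in> ideal_gen A" using assms by (simp add: mult_single xpow_def)
next
  assume "xpow m \<in> ideal_gen A"
  then have "Poly_Mapping.single 0 c * xpow m \<in> ideal_gen A"
    by (rule ring_module.span_scale)
  then show "Poly_Mapping.single m c \<in> ideal_gen A" by (simp add: mult_single xpow_def)
qed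

text \<open>
  A chase in the first three terms of an arbitrary resolution \<open>P\<close>. Fix \<open>u\<close> in
  \<open>P\<^sub>0\<close> with augmentation 1. Exactness provides \<open>F c\<close> with
  \<open>d (F c) = e\<^sub>c - aug c \<cdot> u\<close> and \<open>T i\<close> with \<open>d (T i) = x\<^sub>i u\<close>. Hence
  each basis element of \<open>P\<^sub>1\<close> is, up to a boundary, a combination of the \<open>F c\<close> and one
  \<open>T i\<close>. Summed up for the cycle \<open>v\<close>, the \<open>F c\<close> cancel because
  \<open>d v = 0\<close>, and what remains is a combination with scalars \<open>\<kappa>\<close> of the
  elements \<open>W i = x\<^sup>a / x\<^sub>i \<cdot> T i\<close>, where \<open>i\<close> is a vertex of the shift graph. An edge
  makes \<open>W i - W j\<close> a multiple by an element of \<open>J\<close> of the cycle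
  \<open>x\<^sub>j T i - x\<^sub>i T j\<close>, so it is a boundary. By connectedness all \<open>W i\<close> agree
  modulo boundaries, and the \<open>\<kappa>\<close> add up to zero.
\<close>

lemma cycle_boundary_if_shift_connected:
  fixes P :: "('n, 'k::field) free_complex" and A :: "('n, 'k) mpoly set"
  defines "J \<equiv> ideal_gen A"
  assumes res: "free_resolution_of_field P"
    and conn: "\<And>i j. shift_vertex J a i \<Longrightarrow> shift_vertex J a j \<Longrightarrow> (shift_edge J a)\<^sup>*\<^sup>* i j"
    and cycle: "v \<in> tensor_cycles P 1 J" and hom: "v \<in> homogeneous_vecs P 1 a"
  shows "v \<in> tensor_boundaries P 1 J"
proof -
  define r0 r1 r2 where "r0 = rank P 0" and "r1 = rank P 1" and "r2 = rank P (Suc 1)"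
  define e :: "nat \<Rightarrow> nat \<Rightarrow> ('n, 'k) mpoly" where "e c = (\<lambda>b. if b = c then 1 else 0)" for c
  note boundary_sum = tensor_boundaries_sum[of _ _ P 1 A, folded J_def]
    and boundary_add = tensor_boundaries_add[of _ P 1 A, folded J_def]
    and boundary_scaled = tensor_boundaries_scaled_boundary[of _ A _ P 1, folded J_def r2_def]
  have mg: "multigraded P" using res by (simp add: free_resolution_of_field_def)
  have exact0: "{v \<in> coord_vecs UNIV r0. augmentation P v = 0} = differential P 0 ` coord_vecs UNIV r1"
    and exact1: "{v \<in> coord_vecs UNIV r1. differential P 0 v = (\<lambda>_. 0)}
        = differential P 1 ` coord_vecs UNIV r2"
    using res by (simp_all add: free_resolution_of_field_def r0_def r1_def r2_def)
  have "1 \<in> augmentation P ` coord_vecs UNIV r0"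
    using res by (simp add: free_resolution_of_field_def r0_def)
  then obtain u where u: "u \<in> coord_vecs UNIV r0" "augmentation P u = 1" by auto
  have v: "\<And>b. b < r1 \<Longrightarrow> v b \<in> J" "\<And>b. b \<ge> r1 \<Longrightarrow> v b = 0" "differential P 0 v = (\<lambda>_. 0)"
    using cycle by (auto simp: tensor_cycles_def coord_vecs_def r1_def)
  have lift0: "\<exists>y. y \<in> coord_vecs UNIV r1 \<and> differential P 0 y = z"
    if "z \<in> coord_vecs UNIV r0" "augmentation P z = 0" for z
  proof -
    have "z \<in> differential P 0 ` coord_vecs UNIV r1" unfolding exact0[symmetric] using that by simp
    then show ?thesis by auto
  qed
  have lift1: "\<exists>y. y \<in> coord_vecs UNIV r2 \<and> z = differential P 1 y"
    if "z \<in> coord_vecs UNIV r1" "differential P 0 z = (\<lambda>_. 0)" for z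
  proof -
    have "z \<in> differential P 1 ` coord_vecs UNIV r2" unfolding exact1[symmetric] using that by simp
    then show ?thesis by auto
  qed
  have aug_d: "augmentation P (differential P 0 y) = 0" if "y \<in> coord_vecs UNIV r1" for y
  proof -
    have "differential P 0 y \<in> {v \<in> coord_vecs UNIV r0. augmentation P v = 0}"
      unfolding exact0 using that by (rule imageI)
    then show ?thesis by simp
  qed
  have aug_e: "augmentation P (e c) = aug P c" if "c < r0" for c
    using that by (simp add: augmentation_def e_def r0_def if_distrib[of "\<lambda>f. Poly_Mapping.lookup f 0"]
        if_distrib[of "\<lambda>x. x * _"] cong: if_cong)
  have "\<exists>y. y \<in> coord_vecs UNIV r1 \<and>
      differential P 0 y = (\<lambda>b. e c b - Poly_Mapping.single 0 (aug P c) * u b)" if "c < r0" for c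
  proof (rule lift0)
    show "(\<lambda>b. e c b - Poly_Mapping.single 0 (aug P c) * u b) \<in> coord_vecs UNIV r0"
      using that u(1) by (auto simp: coord_vecs_def e_def)
  qed (use that u(2) in \<open>simp add: augmentation_diff augmentation_smult aug_e\<close>)
  then obtain F where F: "\<And>c. c < r0 \<Longrightarrow> F c \<in> coord_vecs UNIV r1"
      "\<And>c. c < r0 \<Longrightarrow> differential P 0 (F c) = (\<lambda>b. e c b - Poly_Mapping.single 0 (aug P c) * u b)"
    by metis
  have "\<exists>y. y \<in> coord_vecs UNIV r1 \<and> differential P 0 y = (\<lambda>b. var i * u b)" for i
  proof (rule lift0)
    have "Poly_Mapping.single i (1::nat) \<noteq> 0"
      by (metis lookup_single_eq lookup_zero one_neq_zero)
    then have "Poly_Mapping.lookup (var i :: ('n, 'k) mpoly) 0 = 0"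
      by (simp add: var_def xpow_def lookup_single when_def)
    then show "augmentation P (\<lambda>b. var i * u b) = 0" by (simp add: augmentation_smult)
    show "(\<lambda>b. var i * u b) \<in> coord_vecs UNIV r0" using u by (auto simp: coord_vecs_def)
  qed
  then obtain T where T: "\<And>i. T i \<in> coord_vecs UNIV r1"
      "\<And>i. differential P 0 (T i) = (\<lambda>b. var i * u b)"
    by metis

  \<comment> \<open>Modulo the boundaries of the \<open>F c\<close>, \<open>d e\<^sub>b\<close> is \<open>p b\<close> times \<open>u\<close>. Since the augmentation is
    supported in degree 0, \<open>p b\<close> is a term of the degree of \<open>e\<^sub>b\<close>, and it has no constant
    coefficient, so some variable \<open>\<iota> b\<close> divides it.\<close>
  define p where "p b = (\<Sum>c<r0. entry P 0 b c * Poly_Mapping.single 0 (aug P c))" for b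
  define \<kappa> where "\<kappa> b = Poly_Mapping.lookup (v b * p b) a" for b
  have p_keys: "m = bdeg P (Suc 0) b" if b: "b < r1" and m: "m \<in> Poly_Mapping.keys (p b)" for b m
  proof -
    obtain c where c: "c < r0" "m \<in> Poly_Mapping.keys (entry P 0 b c * Poly_Mapping.single 0 (aug P c))"
      using m keys_sum[of "\<lambda>c. entry P 0 b c * Poly_Mapping.single 0 (aug P c)" "{..<r0}"]
      unfolding p_def by blast
    then have "aug P c \<noteq> 0" by auto
    then have deg0: "bdeg P 0 c = 0" using mg c(1) unfolding multigraded_def r0_def by blast
    have "\<forall>m\<in>Poly_Mapping.keys (entry P 0 b c). m + bdeg P 0 c = bdeg P (Suc 0) b"
      using mg c(1) b unfolding multigraded_def r0_def r1_def One_nat_def by blast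
    moreover have "m \<in> Poly_Mapping.keys (entry P 0 b c)"
      using c(2) keys_mult[of "entry P 0 b c" "Poly_Mapping.single 0 (aug P c)"] by (auto split: if_splits)
    ultimately show ?thesis using deg0 by simp
  qed
  have d_e: "differential P 0 (e b) = (\<lambda>c. if c < r0 then entry P 0 b c else 0)" if "b < r1" for b
    using that by (auto simp: differential_def e_def r0_def r1_def if_distrib[of "\<lambda>x. x * _"] cong: if_cong)
  have p_const: "Poly_Mapping.lookup (p b) 0 = 0" if "b < r1" for b
  proof -
    have "e b \<in> coord_vecs UNIV r1" using that by (auto simp: coord_vecs_def e_def)
    then have "augmentation P (differential P 0 (e b)) = 0" by (rule aug_d)
    then show ?thesis using that
      by (simp add: d_e augmentation_def p_def lookup_sum lookup_mult_zero r0_def)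
  qed
  have "\<exists>q i. p b = q * var i \<and> (q \<noteq> 0 \<longrightarrow> (\<exists>n. a = n + Poly_Mapping.single i 1 \<and> xpow n \<in> J
      \<and> v b * q = Poly_Mapping.single 0 (\<kappa> b) * xpow n))" if b: "b < r1" "v b \<noteq> 0" for b
  proof (cases "p b = 0")
    case True
    then show ?thesis by (intro exI[of _ 0]) auto
  next
    case False
    define s where "s = bdeg P (Suc 0) b"
    define \<beta> where "\<beta> = Poly_Mapping.lookup (p b) s"
    have p: "p b = Poly_Mapping.single s \<beta>"
      unfolding \<beta>_def s_def using p_keys[OF b(1)] by (rule homogeneous_mpoly_eq_single)
    obtain m where m: "m \<in> Poly_Mapping.keys (v b)" using b(2) by fastforce
    have keys_v: "x + s = a" if "x \<in> Poly_Mapping.keys (v b)" for x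
      using hom b(1) that by (auto simp: homogeneous_vecs_def r1_def s_def)
    define \<gamma> where "\<gamma> = Poly_Mapping.lookup (v b) m"
    have vb: "v b = Poly_Mapping.single m \<gamma>" unfolding \<gamma>_def
      using keys_v keys_v[OF m] by (intro homogeneous_mpoly_eq_single) (metis add_right_cancel)
    have "\<gamma> \<noteq> 0" using m by (simp add: \<gamma>_def in_keys_iff)
    then have mJ: "xpow m \<in> J" using v(1)[OF b(1)] by (simp add: vb J_def single_in_ideal_iff)
    have \<kappa>: "\<kappa> b = \<gamma> * \<beta>" unfolding \<kappa>_def vb p mult_single using keys_v[OF m] by simp
    have "s \<noteq> 0" using p_const[OF b(1)] False p by auto
    then obtain i where i: "Poly_Mapping.lookup s i \<noteq> 0" by (metis poly_mapping_eqI lookup_zero)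
    define t where "t = s - Poly_Mapping.single i 1"
    have t: "s = t + Poly_Mapping.single i 1"
      using i by (intro poly_mapping_eqI) (auto simp: t_def lookup_add lookup_minus lookup_single when_def)
    have "p b = Poly_Mapping.single t \<beta> * var i" by (simp add: p t var_def xpow_def mult_single)
    moreover have "a = (m + t) + Poly_Mapping.single i 1" using keys_v[OF m] t by (simp add: add.assoc)
    moreover have "xpow (m + t) \<in> J"
      using ring_module.span_scale[OF mJ[unfolded J_def], of "xpow t"]
      unfolding J_def by (simp add: xpow_add mult.commute)
    moreover have "v b * Poly_Mapping.single t \<beta> = Poly_Mapping.single 0 (\<kappa> b) * xpow (m + t)"
      by (simp add: vb \<kappa> mult_single xpow_def)
    ultimately show ?thesis by blast
  qed
  then obtain q \<iota> where q: "\<And>b. b < r1 \<Longrightarrow> v b \<noteq> 0 \<Longrightarrow> p b = q b * var (\<iota> b)"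
    and q_vertex: "\<And>b. b < r1 \<Longrightarrow> v b \<noteq> 0 \<Longrightarrow> q b \<noteq> 0 \<Longrightarrow>
      \<exists>n. a = n + Poly_Mapping.single (\<iota> b) 1 \<and> xpow n \<in> J
      \<and> v b * q b = Poly_Mapping.single 0 (\<kappa> b) * xpow n"
    by metis

  define S where "S = {b. b < r1 \<and> v b \<noteq> 0}"
  have "finite S" by (simp add: S_def)
  \<comment> \<open>The vectors \<open>z b\<close> are cycles and so boundaries over the polynomial ring; multiplied by
    \<open>v b \<in> J\<close> they become boundaries with coefficients in \<open>J\<close>.\<close>
  define z where "z b = (\<lambda>x. e b x - (\<Sum>c<r0. entry P 0 b c * F c x) - q b * T (\<iota> b) x)" for b
  have "\<exists>y. y \<in> coord_vecs UNIV r2 \<and> z b = differential P 1 y" if "b \<in> S" for b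
  proof -
    have b: "b < r1" "v b \<noteq> 0" using that by (auto simp: S_def)
    have "differential P 0 (z b) x = 0" for x
    proof -
      have "(\<Sum>c<r0. entry P 0 b c * (e c x - Poly_Mapping.single 0 (aug P c) * u x))
          = (if x < r0 then entry P 0 b x else 0) - p b * u x"
        by (simp add: right_diff_distrib sum_subtractf p_def e_def sum_distrib_right mult.assoc
            if_distrib[of "\<lambda>f. _ * f"] cong: if_cong)
      then show ?thesis
        using q[OF b] unfolding z_def differential_diff differential_sum differential_smult
        by (simp add: F(2) T(2) d_e[OF b(1)] mult.assoc)
    qed
    moreover have "z b \<in> coord_vecs UNIV r1"
      using F(1) T(1) b(1) by (auto simp: coord_vecs_def z_def e_def)
    ultimately show ?thesis by (intro lift1) auto
  qed
  then obtain y where y: "\<And>b. b \<in> S \<Longrightarrow> y b \<in> coord_vecs UNIV r2"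
      "\<And>b. b \<in> S \<Longrightarrow> z b = differential P 1 (y b)"
    by metis
  have dv: "(\<Sum>b\<in>S. v b * entry P 0 b c) = 0" if "c < r0" for c
  proof -
    have "(\<Sum>b\<in>S. v b * entry P 0 b c) = (\<Sum>b<r1. v b * entry P 0 b c)"
      by (rule sum.mono_neutral_left) (auto simp: S_def)
    also have "\<dots> = 0" using fun_cong[OF v(3), of c] that by (simp add: differential_def r0_def r1_def)
    finally show ?thesis .
  qed
  have decomp: "v = (\<lambda>x. (\<Sum>b\<in>S. v b * z b x) + (\<Sum>b\<in>S. v b * q b * T (\<iota> b) x))"
  proof
    fix x
    have "(\<Sum>b\<in>S. v b * (\<Sum>c<r0. entry P 0 b c * F c x))
        = (\<Sum>c<r0. (\<Sum>b\<in>S. v b * entry P 0 b c) * F c x)"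
      by (simp add: sum_distrib_left sum_distrib_right mult.assoc sum.swap[of _ S])
    also have "\<dots> = 0" by (simp add: dv)
    finally have "(\<Sum>b\<in>S. v b * (\<Sum>c<r0. entry P 0 b c * F c x)) = 0" .
    moreover have "(\<Sum>b\<in>S. v b * e b x) = v x"
      using \<open>finite S\<close> v(2)[of x] by (auto simp: e_def if_distrib[of "\<lambda>f. _ * f"] S_def cong: if_cong)
    ultimately show "v x = (\<Sum>b\<in>S. v b * z b x) + (\<Sum>b\<in>S. v b * q b * T (\<iota> b) x)"
      by (simp add: z_def right_diff_distrib sum_subtractf mult.assoc)
  qed
  have part1: "(\<lambda>x. \<Sum>b\<in>S. v b * z b x) \<in> tensor_boundaries P 1 J"
  proof -
    have "(\<lambda>x. v b * z b x) \<in> tensor_boundaries P 1 J" if "b \<in> S" for b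
      unfolding y(2)[OF that] using that v(1) y(1)[OF that] by (intro boundary_scaled) (simp_all add: S_def)
    then have "(\<lambda>x. \<Sum>b\<in>S. 1 * (v b * z b x)) \<in> tensor_boundaries P 1 J"
      by (rule boundary_sum)
    then show ?thesis by simp
  qed

  define W where "W i = (\<lambda>x. xpow (a - Poly_Mapping.single i 1) * T i x)" for i
  have W_edge: "(\<lambda>x. W i x - W j x) \<in> tensor_boundaries P 1 J" if edge: "shift_edge J a i j" for i j
  proof -
    obtain m where m: "a = m + Poly_Mapping.single i 1 + Poly_Mapping.single j 1" "xpow m \<in> J"
      using edge by (auto simp: shift_edge_def)
    have "a = m + Poly_Mapping.single j 1 + Poly_Mapping.single i 1"
      unfolding m(1) by (simp only: ac_simps)
    then have ai: "a - Poly_Mapping.single i 1 = m + Poly_Mapping.single j 1" by simp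
    have aj: "a - Poly_Mapping.single j 1 = m + Poly_Mapping.single i 1" by (simp add: m(1))
    define w where "w = (\<lambda>x. var j * T i x - var i * T j x)"
    have "differential P 0 w = (\<lambda>_. 0)"
      unfolding w_def differential_diff differential_smult T(2) by (simp add: mult.left_commute)
    moreover have "w \<in> coord_vecs UNIV r1" using T(1) by (auto simp: w_def coord_vecs_def)
    ultimately obtain y where y: "y \<in> coord_vecs UNIV r2" "w = differential P 1 y" using lift1 by metis
    have "(\<lambda>x. xpow m * w x) \<in> tensor_boundaries P 1 J"
      unfolding y(2) using m(2) y(1) by (rule boundary_scaled)
    moreover have "(\<lambda>x. W i x - W j x) = (\<lambda>x. xpow m * w x)"
      unfolding W_def ai aj xpow_add w_def var_def by (simp add: right_diff_distrib mult.assoc)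
    ultimately show ?thesis by simp
  qed
  have W_conn: "(\<lambda>x. W i x - W j x) \<in> tensor_boundaries P 1 J" if "(shift_edge J a)\<^sup>*\<^sup>* i j" for i j
    using that
  proof (induction rule: rtranclp_induct)
    case base
    show ?case using boundary_sum[of "{}"] by simp
  next
    case (step j k)
    show ?case using boundary_add[OF step.IH W_edge[OF step.hyps(2)]] by simp
  qed
  define S' where "S' = {b \<in> S. q b \<noteq> 0}"
  have vertex: "shift_vertex J a (\<iota> b)"
    and summand: "v b * q b * T (\<iota> b) x = Poly_Mapping.single 0 (\<kappa> b) * W (\<iota> b) x" if "b \<in> S'" for b x
  proof -
    have b: "b < r1" "v b \<noteq> 0" "q b \<noteq> 0" using that by (auto simp: S'_def S_def)
    from q_vertex[OF this] obtain n where n: "a = n + Poly_Mapping.single (\<iota> b) 1" "xpow n \<in> J"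
      "v b * q b = Poly_Mapping.single 0 (\<kappa> b) * xpow n" by blast
    then show "shift_vertex J a (\<iota> b)" by (auto simp: shift_vertex_def)
    have "a - Poly_Mapping.single (\<iota> b) 1 = n" by (simp add: n(1))
    then show "v b * q b * T (\<iota> b) x = Poly_Mapping.single 0 (\<kappa> b) * W (\<iota> b) x"
      by (simp add: n(3) W_def mult.assoc)
  qed
  have \<kappa>_sum: "(\<Sum>b\<in>S'. \<kappa> b) = 0"
  proof -
    have "(\<Sum>b\<in>S'. \<kappa> b) = (\<Sum>b\<in>S. \<kappa> b)"
      using \<open>finite S\<close> q by (intro sum.mono_neutral_left) (auto simp: S'_def S_def \<kappa>_def)
    also have "\<dots> = Poly_Mapping.lookup (\<Sum>b\<in>S. v b * p b) a" by (simp add: \<kappa>_def lookup_sum)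
    also have "(\<Sum>b\<in>S. v b * p b)
        = (\<Sum>c<r0. (\<Sum>b\<in>S. v b * entry P 0 b c) * Poly_Mapping.single 0 (aug P c))"
      by (simp add: p_def sum_distrib_left sum_distrib_right mult.assoc sum.swap[of _ S])
    also have "\<dots> = 0" by (simp add: dv)
    finally show ?thesis by simp
  qed
  have part2: "(\<lambda>x. \<Sum>b\<in>S. v b * q b * T (\<iota> b) x) \<in> tensor_boundaries P 1 J"
  proof -
    have restrict: "(\<lambda>x. \<Sum>b\<in>S. v b * q b * T (\<iota> b) x)
        = (\<lambda>x. \<Sum>b\<in>S'. Poly_Mapping.single 0 (\<kappa> b) * W (\<iota> b) x)"
    proof
      fix x
      have "(\<Sum>b\<in>S. v b * q b * T (\<iota> b) x) = (\<Sum>b\<in>S'. v b * q b * T (\<iota> b) x)"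
        using \<open>finite S\<close> by (intro sum.mono_neutral_right) (auto simp: S'_def)
      then show "(\<Sum>b\<in>S. v b * q b * T (\<iota> b) x) = (\<Sum>b\<in>S'. Poly_Mapping.single 0 (\<kappa> b) * W (\<iota> b) x)"
        using summand by simp
    qed
    show ?thesis
    proof (cases "S' = {}")
      case True
      then show ?thesis unfolding restrict using boundary_sum[of "{}"] by simp
    next
      case False
      then obtain b0 where b0: "b0 \<in> S'" by blast
      have "(\<lambda>x. \<Sum>b\<in>S'. Poly_Mapping.single 0 (\<kappa> b) * (W (\<iota> b) x - W (\<iota> b0) x))
          \<in> tensor_boundaries P 1 J"
        using vertex b0 by (intro boundary_sum W_conn conn)
      moreover have "(\<Sum>b\<in>S'. Poly_Mapping.single 0 (\<kappa> b)) = (0 :: ('n, 'k) mpoly)"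
      proof (rule poly_mapping_eqI)
        fix m :: "'n \<Rightarrow>\<^sub>0 nat"
        show "Poly_Mapping.lookup (\<Sum>b\<in>S'. Poly_Mapping.single 0 (\<kappa> b)) m = Poly_Mapping.lookup 0 m"
          using \<kappa>_sum by (cases "m = 0") (simp_all add: lookup_sum lookup_single)
      qed
      ultimately show ?thesis
        unfolding restrict by (simp add: right_diff_distrib sum_subtractf flip: sum_distrib_right)
    qed
  qed
  show ?thesis by (subst decomp) (rule boundary_add[OF part1 part2])
qed


section \<open>A free resolution of the residue field by tuples of variables\<close>

definition nth_var :: "nat \<Rightarrow> 'n::finite"
  where "nth_var = (SOME f. bij_betw f {..<CARD('n)} UNIV)"

lemma bij_nth_var: "bij_betw (nth_var :: nat \<Rightarrow> 'n::finite) {..<CARD('n)} UNIV"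
proof -
  have "\<exists>f :: nat \<Rightarrow> 'n. bij_betw f {..<CARD('n)} UNIV"
    by (rule finite_same_card_bij) simp_all
  then show ?thesis unfolding nth_var_def by (rule someI_ex)
qed

text \<open>
  The basis of the \<open>i\<close>-th free module consists of all \<open>i\<close>-tuples of variables,
  repetitions allowed. A tuple is coded by the number whose \<open>i\<close> lowest digits in base
  \<open>CARD('n)\<close> are its entries, the first entry being the lowest digit.
\<close>

primrec tuple_set :: "nat \<Rightarrow> nat \<Rightarrow> 'n::finite set"
  where
    "tuple_set 0 b = {}"
  | "tuple_set (Suc i) b = insert (nth_var (b mod CARD('n))) (tuple_set i (b div CARD('n)))"

text \<open>
  The alternating sum over the deletion of one entry, in recursive form: the boundary of
  \<open>p # t\<close> is \<open>t\<close> minus \<open>p #\<close> the boundary of \<open>t\<close>. The number of variables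
  \<open>n\<close> is a parameter because the type of the variables does not occur in the type of
  this function.
\<close>

primrec face_coeff :: "nat \<Rightarrow> nat \<Rightarrow> nat \<Rightarrow> nat \<Rightarrow> 'k::field"
  where
    "face_coeff n 0 b c = 1"
  | "face_coeff n (Suc i) b c = (if c = b div n then 1 else 0)
       - (if c mod n = b mod n then face_coeff n i (b div n) (c div n) else 0)"

text \<open>
  In multidegree \<open>a\<close> this is the augmented complex of ordered chains of the full
  simplex on the support of \<open>a\<close>. Compared with the Koszul complex it is far from minimal,
  but no signs of permutations occur, and prepending a variable of the support is a
  contracting homotopy.
\<close>

definition tuple_complex :: "('n::finite, 'k::field) free_complex"
  where "tuple_complex =
    \<lparr> rank = (\<lambda>i. CARD('n) ^ i),
      bdeg = (\<lambda>i b. ind (tuple_set i b)),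
      entry = (\<lambda>i b c. Poly_Mapping.single (ind (tuple_set (Suc i) b) - ind (tuple_set i c))
                  (face_coeff CARD('n) i b c)),
      aug = (\<lambda>c. 1) \<rparr>"

lemma ind_mono: "X \<subseteq> Y \<Longrightarrow> mono_dvd (ind X) (ind (Y :: 'n::finite set))"
  by (auto simp: mono_dvd_iff_lookup_le lookup_ind)

lemma face_coeff_nonzero_subset:
  "(face_coeff CARD('n::finite) i b c :: 'k::field) \<noteq> 0 \<Longrightarrow>
    (tuple_set i c :: 'n set) \<subseteq> tuple_set (Suc i) b"
proof (induction i arbitrary: b c)
  case (Suc i)
  show ?case
  proof (cases "c = b div CARD('n)")
    case False
    with Suc.prems have *: "c mod CARD('n) = b mod CARD('n)"
      "(face_coeff CARD('n) i (b div CARD('n)) (c div CARD('n)) :: 'k) \<noteq> 0"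
      by (auto split: if_splits)
    have "(tuple_set i (c div CARD('n)) :: 'n set) \<subseteq> tuple_set (Suc i) (b div CARD('n))"
      by (rule Suc.IH[OF *(2)])
    then show ?thesis
      unfolding tuple_set.simps(2)[of i c] tuple_set.simps(2)[of "Suc i" b] *(1) by blast
  qed (simp add: subset_insertI)
qed simp

text \<open>
  Summation over the tuples with a given first entry.
\<close>

lemma sum_digits:
  fixes g :: "nat \<Rightarrow> 'b::comm_monoid_add"
  assumes "p < n"
  shows "(\<Sum>r<n ^ Suc i. if r mod n = p then g r else 0) = (\<Sum>r<n ^ i. g (p + n * r))"
proof -
  have "{r \<in> {..<n ^ Suc i}. r mod n = p} = (\<lambda>r. p + n * r) ` {..<n ^ i}"
  proof (intro set_eqI iffI)
    fix r assume r: "r \<in> {r \<in> {..<n ^ Suc i}. r mod n = p}"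
    then have "r div n < n ^ i" by (simp add: less_mult_imp_div_less mult.commute)
    moreover have "r = p + n * (r div n)" using r by (metis (mono_tags) mem_Collect_eq mod_mult_div_eq)
    ultimately show "r \<in> (\<lambda>r. p + n * r) ` {..<n ^ i}" by blast
  next
    fix r assume "r \<in> (\<lambda>r. p + n * r) ` {..<n ^ i}"
    then obtain s where s: "s < n ^ i" "r = p + n * s" by blast
    have "r < n * Suc s" using s(2) assms by simp
    moreover have "n * Suc s \<le> n * n ^ i" using s(1) by (intro mult_le_mono2) simp
    ultimately show "r \<in> {r \<in> {..<n ^ Suc i}. r mod n = p}" using s assms by simp
  qed
  moreover have "inj_on (\<lambda>r. p + n * r) {..<n ^ i}" using assms by (auto intro!: inj_onI)
  ultimately show ?thesis by (simp only: sum.inter_filter[OF finite_lessThan, symmetric] sum.reindex o_def)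
qed

text \<open>
  In operator form, with \<open>j #\<close> for prepending: from \<open>d (j # t) = t - j # d t\<close> it follows
  that \<open>d (d (j # t)) = d t - d (j # d t) = j # d (d t)\<close>, which vanishes by induction.
\<close>

lemma face_coeff_face_coeff:
  assumes "b < n ^ Suc (Suc i)" "c < n ^ i"
  shows "(\<Sum>r<n ^ Suc i. face_coeff n (Suc i) b r * face_coeff n i r c) = (0 :: 'k::field)"
  using assms
proof (induction i arbitrary: b c)
  case (0 b c)
  then have "n > 0" by (cases n) auto
  have "b div n < n" using 0 by (simp add: less_mult_imp_div_less)
  moreover have "(\<Sum>r<n ^ Suc 0. if r mod n = b mod n then 1 else 0 :: 'k) = 1"
    using \<open>n > 0\<close> by (subst sum_digits) simp_all
  ultimately show ?case by (simp add: sum_subtractf)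
next
  case (Suc i b c)
  then have "n > 0" by (cases n) auto
  define p where "p = b mod n"
  have p: "p < n" using \<open>n > 0\<close> by (simp add: p_def)
  have bd: "b div n < n ^ Suc (Suc i)" using Suc.prems(1) by (simp add: less_mult_imp_div_less mult.commute)
  have cd: "c div n < n ^ i" using Suc.prems(2) by (simp add: less_mult_imp_div_less mult.commute)
  let ?f = "\<lambda>i b c. face_coeff n i b c :: 'k"
  have "(\<Sum>r<n ^ Suc i. ?f (Suc i) (b div n) r * ?f (Suc i) (p + n * r) c)
      = (\<Sum>r<n ^ Suc i. if r = c then ?f (Suc i) (b div n) c else 0)
        - (if c mod n = p then \<Sum>r<n ^ Suc i. ?f (Suc i) (b div n) r * ?f i r (c div n) else 0)"
  proof -
    have "?f (Suc i) (b div n) r * ?f (Suc i) (p + n * r) c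
        = (if r = c then ?f (Suc i) (b div n) c else 0)
          - (if c mod n = p then ?f (Suc i) (b div n) r * ?f i r (c div n) else 0)" for r
    proof -
      have "(p + n * r) div n = r" "(p + n * r) mod n = p" using p by simp_all
      then show ?thesis
        unfolding face_coeff.simps(2)[of n i "p + n * r" c]
        by (auto simp: right_diff_distrib simp del: face_coeff.simps)
    qed
    then show ?thesis by (simp add: sum_subtractf del: face_coeff.simps)
  qed
  also have "\<dots> = ?f (Suc i) (b div n) c"
    using Suc.prems(2) Suc.IH[OF bd cd] by (simp del: face_coeff.simps)
  finally have *: "(\<Sum>r<n ^ Suc i. ?f (Suc i) (b div n) r * ?f (Suc i) (p + n * r) c) = ?f (Suc i) (b div n) c" .
  have "(\<Sum>r<n ^ Suc (Suc i). ?f (Suc (Suc i)) b r * ?f (Suc i) r c)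
      = (\<Sum>r<n ^ Suc (Suc i). if r = b div n then ?f (Suc i) r c else 0)
        - (\<Sum>r<n ^ Suc (Suc i). if r mod n = p then ?f (Suc i) (b div n) (r div n) * ?f (Suc i) r c else 0)"
    unfolding face_coeff.simps(2)[of n "Suc i"] sum_subtractf[symmetric] p_def
    by (intro sum.cong) (auto simp: left_diff_distrib simp del: face_coeff.simps)
  also have "(\<Sum>r<n ^ Suc (Suc i). if r = b div n then ?f (Suc i) r c else 0) = ?f (Suc i) (b div n) c"
    using bd by (simp del: face_coeff.simps)
  also have "(\<Sum>r<n ^ Suc (Suc i). if r mod n = p then ?f (Suc i) (b div n) (r div n) * ?f (Suc i) r c else 0)
      = (\<Sum>r<n ^ Suc i. ?f (Suc i) (b div n) r * ?f (Suc i) (p + n * r) c)"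
    using p by (simp del: face_coeff.simps power_Suc add: sum_digits)
  finally show ?case using * by simp
qed

lemma lookup_mult_single:
  fixes f :: "('n, 'k::field) mpoly"
  shows "Poly_Mapping.lookup (f * Poly_Mapping.single t c) m
    = (if mono_dvd t m then Poly_Mapping.lookup f (m - t) * c else 0)"
proof -
  have "f * Poly_Mapping.single t c
      = (\<Sum>k\<in>Poly_Mapping.keys f. Poly_Mapping.single (k + t) (Poly_Mapping.lookup f k * c))"
    by (subst mpoly_eq_sum_monomials[of f]) (simp add: sum_distrib_right mult_single)
  then have eq: "Poly_Mapping.lookup (f * Poly_Mapping.single t c) m
      = (\<Sum>k\<in>Poly_Mapping.keys f. if k + t = m then Poly_Mapping.lookup f k * c else 0)"
    by (simp add: lookup_sum lookup_single when_def)
  show ?thesis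
  proof (cases "mono_dvd t m")
    case True
    then obtain s where s: "m = t + s" by blast
    have "k + t = m \<longleftrightarrow> k = s" for k unfolding s by (metis add.commute add_left_cancel)
    then show ?thesis unfolding eq using s by (auto simp: in_keys_iff)
  next
    case False
    then have "k + t \<noteq> m" for k by (metis add.commute)
    then show ?thesis using False by (simp add: eq)
  qed
qed

text \<open>
  A homogeneous component of degree \<open>a\<close> is determined by one scalar per basis element,
  the coefficient of the only monomial that has the right degree.
\<close>

definition strand :: "nat \<Rightarrow> ('n::finite \<Rightarrow>\<^sub>0 nat) \<Rightarrow> (nat \<Rightarrow> ('n, 'k::field) mpoly) \<Rightarrow> nat \<Rightarrow> 'k"
  where "strand i a v b =
    (if mono_dvd (ind (tuple_set i b)) a then Poly_Mapping.lookup (v b) (a - ind (tuple_set i b)) else 0)"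

lemma strand_null [simp]: "strand i a (\<lambda>_. 0) b = 0"
  by (simp add: strand_def)

lemma strand_eqI:
  fixes v w :: "nat \<Rightarrow> ('n::finite, 'k::field) mpoly"
  assumes "v \<in> coord_vecs UNIV r" "w \<in> coord_vecs UNIV r"
    and "\<And>a b. b < r \<Longrightarrow> strand i a v b = strand i a w b"
  shows "v = w"
proof
  fix b
  show "v b = w b"
  proof (cases "b < r")
    case True
    show ?thesis
    proof (rule poly_mapping_eqI)
      fix m
      show "Poly_Mapping.lookup (v b) m = Poly_Mapping.lookup (w b) m"
        using assms(3)[OF True, of "ind (tuple_set i b) + m"] by (simp add: strand_def)
    qed
  next
    case False
    then show ?thesis using assms by (auto simp: coord_vecs_def)
  qed
qed

text \<open>
  On the scalars of a fixed multidegree the differential acts by the matrix \<open>face_coeff\<close>.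
  If the degree of \<open>c\<close> does not divide \<open>a\<close>, both sides are zero, since then the
  degrees of the tuples having \<open>c\<close> as a face do not divide \<open>a\<close> either.
\<close>

lemma strand_differential:
  fixes v :: "nat \<Rightarrow> ('n::finite, 'k::field) mpoly"
  assumes "c < CARD('n) ^ i"
  shows "strand i a (differential tuple_complex i v) c
    = (\<Sum>b<CARD('n) ^ Suc i. strand (Suc i) a v b * face_coeff CARD('n) i b c)"
proof -
  have summand: "(if mono_dvd (ind (tuple_set i c)) a then
        Poly_Mapping.lookup (v b * entry tuple_complex i b c) (a - ind (tuple_set i c)) else 0)
      = strand (Suc i) a v b * face_coeff CARD('n) i b c" for b
  proof (cases "(face_coeff CARD('n) i b c :: 'k) = 0")
    case True
    then show ?thesis by (simp add: tuple_complex_def)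
  next
    case False
    obtain t where t: "ind (tuple_set (Suc i) b :: 'n set) = ind (tuple_set i c) + t"
      using ind_mono[OF face_coeff_nonzero_subset[OF False]] by blast
    show ?thesis
    proof (cases "mono_dvd (ind (tuple_set i c)) a")
      case True
      then obtain x where x: "a = ind (tuple_set i c) + x" by blast
      have "mono_dvd (ind (tuple_set (Suc i) b)) a \<longleftrightarrow> mono_dvd t x"
        unfolding t x add.assoc by (simp only: add_left_cancel)
      moreover have "a - ind (tuple_set (Suc i) b) = x - t"
        unfolding t x by (simp only: diff_diff_eq[symmetric] add_diff_cancel_left')
      moreover have "ind (tuple_set (Suc i) b) - ind (tuple_set i c) = t"
        unfolding t by (simp only: add_diff_cancel_left')
      moreover have "a - ind (tuple_set i c) = x" by (simp add: x)
      ultimately show ?thesis using True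
        by (simp add: tuple_complex_def strand_def lookup_mult_single del: tuple_set.simps)
    next
      case False
      then have "\<not> mono_dvd (ind (tuple_set (Suc i) b)) a"
        unfolding t using mono_dvd_addD by blast
      with False show ?thesis by (simp add: strand_def del: tuple_set.simps)
    qed
  qed
  have "strand i a (differential tuple_complex i v) c
     = (\<Sum>b<CARD('n) ^ Suc i. if mono_dvd (ind (tuple_set i c)) a then
        Poly_Mapping.lookup (v b * entry tuple_complex i b c) (a - ind (tuple_set i c)) else 0)"
    using assms by (simp add: strand_def differential_def lookup_sum tuple_complex_def)
  then show ?thesis by (simp only: summand)
qed

lemma differential_in_coord_vecs:
  "differential P i v \<in> coord_vecs UNIV (rank P i)"
  by (simp add: coord_vecs_def differential_def)

lemma rank_tuple_complex [simp]:
  "rank (tuple_complex :: ('n::finite, 'k::field) free_complex) i = CARD('n) ^ i"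
  by (simp add: tuple_complex_def)

lemma differential_differential_tuple_complex:
  fixes v :: "nat \<Rightarrow> ('n::finite, 'k::field) mpoly"
  shows "differential tuple_complex i (differential tuple_complex (Suc i) v) = (\<lambda>_. 0)"
proof (rule strand_eqI)
  show "differential tuple_complex i (differential tuple_complex (Suc i) v) \<in> coord_vecs UNIV (CARD('n) ^ i)"
    using differential_in_coord_vecs[of tuple_complex i] by simp
  show "(\<lambda>_. 0) \<in> coord_vecs UNIV (CARD('n) ^ i)" by (simp add: coord_vecs_def)
  fix a b assume b: "b < CARD('n) ^ i"
  let ?f = "face_coeff CARD('n) :: nat \<Rightarrow> nat \<Rightarrow> nat \<Rightarrow> 'k"
  have "strand i a (differential tuple_complex i (differential tuple_complex (Suc i) v)) b
      = (\<Sum>r<CARD('n) ^ Suc i. (\<Sum>s<CARD('n) ^ Suc (Suc i). strand (Suc (Suc i)) a v s * ?f (Suc i) s r) * ?f i r b)"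
    unfolding strand_differential[OF b]
    by (intro sum.cong refl) (simp only: strand_differential lessThan_iff)
  also have "\<dots> = (\<Sum>s<CARD('n) ^ Suc (Suc i). strand (Suc (Suc i)) a v s
      * (\<Sum>r<CARD('n) ^ Suc i. ?f (Suc i) s r * ?f i r b))"
    unfolding sum_distrib_right sum_distrib_left mult.assoc by (rule sum.swap)
  also have "\<dots> = 0"
  proof (intro sum.neutral ballI)
    fix s assume "s \<in> {..<CARD('n) ^ Suc (Suc i)}"
    then have "(\<Sum>r<CARD('n) ^ Suc i. ?f (Suc i) s r * ?f i r b) = 0"
      using b by (intro face_coeff_face_coeff) (simp_all only: lessThan_iff)
    then show "strand (Suc (Suc i)) a v s * (\<Sum>r<CARD('n) ^ Suc i. ?f (Suc i) s r * ?f i r b) = 0"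
      by (simp only: mult_zero_right)
  qed
  finally show "strand i a (differential tuple_complex i (differential tuple_complex (Suc i) v)) b
      = strand i a (\<lambda>_. 0) b" by (simp add: strand_def)
qed

text \<open>
  The contracting homotopy. In degree \<open>a \<noteq> 0\<close> a preimage is obtained by prepending a variable
  \<open>J a\<close> in the support of \<open>a\<close>; this keeps the degree of every tuple that occurs
  a divisor of \<open>a\<close>. The hypothesis \<open>contract\<close> says that the homotopy followed by
  the differential fixes \<open>v\<close>. It covers both cycles in positive homological degree and
  elements in the kernel of the augmentation. The vector \<open>w\<close> collects the preimages of
  all multidegrees at once, monomial by monomial.
\<close>

lemma boundary_if_strands_contractible:
  fixes v :: "nat \<Rightarrow> ('n::finite, 'k::field) mpoly"
  assumes v: "v \<in> coord_vecs UNIV (CARD('n) ^ i)"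
    and zero: "\<And>b. b < CARD('n) ^ i \<Longrightarrow> strand i 0 v b = 0"
    and contract: "\<And>a j c. j < CARD('n) \<Longrightarrow> c < CARD('n) ^ i \<Longrightarrow>
      (\<Sum>b<CARD('n) ^ i. strand i a v b * face_coeff CARD('n) i (j + CARD('n) * b) c) = strand i a v c"
  shows "v \<in> differential tuple_complex i ` coord_vecs UNIV (CARD('n) ^ Suc i)"
proof -
  let ?n = "CARD('n)"
  let ?d = "\<lambda>i b. ind (tuple_set i b) :: 'n \<Rightarrow>\<^sub>0 nat"
  have "\<exists>j<?n. Poly_Mapping.lookup a (nth_var j) > 0" if nz: "a \<noteq> 0" for a :: "'n \<Rightarrow>\<^sub>0 nat"
  proof -
    obtain x where "Poly_Mapping.lookup a x \<noteq> 0" using nz by (metis poly_mapping_eqI lookup_zero)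
    moreover have "x \<in> nth_var ` {..<?n}" using bij_nth_var[where 'n = 'n] by (simp add: bij_betw_def)
    then obtain j where "j < ?n" "nth_var j = x" by auto
    ultimately show ?thesis by auto
  qed
  then obtain J :: "('n \<Rightarrow>\<^sub>0 nat) \<Rightarrow> nat" where J: "\<And>a. a \<noteq> 0 \<Longrightarrow> J a < ?n"
      "\<And>a. a \<noteq> 0 \<Longrightarrow> Poly_Mapping.lookup a (nth_var (J a) :: 'n) > 0"
    by metis
  define w where "w b = (if b < ?n ^ Suc i then
      \<Sum>m\<in>Poly_Mapping.keys (v (b div ?n)).
        if m + ?d i (b div ?n) \<noteq> 0 \<and> b mod ?n = J (m + ?d i (b div ?n))
        then Poly_Mapping.single (m + ?d i (b div ?n) - ?d (Suc i) b) (Poly_Mapping.lookup (v (b div ?n)) m)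
        else 0
      else 0)" for b
  have strand_w: "strand (Suc i) a w b
      = (if a \<noteq> 0 \<and> b mod ?n = J a then strand i a v (b div ?n) else 0)" if b: "b < ?n ^ Suc i" for a b
  proof -
    define d D where "d = ?d i (b div ?n)" and "D = ?d (Suc i) b"
    have dD: "mono_dvd d D" unfolding d_def D_def by (rule ind_mono) auto
    have above: "mono_dvd D x"
      if "mono_dvd d x" "x \<noteq> 0" "b mod ?n = J x" for x
      unfolding mono_dvd_iff_lookup_le
    proof
      fix y
      have "Poly_Mapping.lookup d y \<le> Poly_Mapping.lookup x y"
        using that(1) unfolding mono_dvd_iff_lookup_le ..
      then show "Poly_Mapping.lookup D y \<le> Poly_Mapping.lookup x y"
        using J(2)[OF that(2)] that(3) by (auto simp: d_def D_def lookup_ind Suc_le_eq split: if_splits)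
    qed
    show ?thesis
    proof (cases "mono_dvd D a")
      case False
      then show ?thesis using above by (auto simp: strand_def simp flip: d_def D_def simp del: tuple_set.simps)
    next
      case True
      then have da: "mono_dvd d a" using dD mono_dvd_addD by blast
      then obtain s where s: "a = d + s" by blast
      have eq: "m + d - D = a - D \<longleftrightarrow> m = s"
        if "m + d \<noteq> 0" "b mod ?n = J (m + d)" for m
      proof -
        have "mono_dvd D (m + d)" using above that by (metis add.commute)
        then obtain x where x: "m + d = D + x" by blast
        obtain y where y: "a = D + y" using True by blast
        show ?thesis unfolding x y using x y s by (metis add.commute add_left_cancel add_diff_cancel_left')
      qed
      have "strand (Suc i) a w b = Poly_Mapping.lookup (w b) (a - D)"
        using True by (simp add: strand_def D_def del: tuple_set.simps)
      also have "\<dots> = (\<Sum>m\<in>Poly_Mapping.keys (v (b div ?n)).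
          if m + d \<noteq> 0 \<and> b mod ?n = J (m + d) \<and> m + d - D = a - D
          then Poly_Mapping.lookup (v (b div ?n)) m else 0)"
        unfolding w_def d_def[symmetric] D_def[symmetric] using b
        by (auto simp: lookup_sum lookup_single when_def intro!: sum.cong)
      also have "\<dots> = (\<Sum>m\<in>Poly_Mapping.keys (v (b div ?n)).
          if m = s then (if a \<noteq> 0 \<and> b mod ?n = J a then Poly_Mapping.lookup (v (b div ?n)) s else 0) else 0)"
        using eq by (intro sum.cong refl) (auto simp: s add.commute)
      also have "\<dots> = (if a \<noteq> 0 \<and> b mod ?n = J a then Poly_Mapping.lookup (v (b div ?n)) s else 0)"
        by (simp add: in_keys_iff)
      also have "\<dots> = (if a \<noteq> 0 \<and> b mod ?n = J a then strand i a v (b div ?n) else 0)"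
        unfolding strand_def d_def[symmetric] using da by (simp add: s)
      finally show ?thesis .
    qed
  qed
  have "v = differential tuple_complex i w"
  proof (rule strand_eqI[OF v])
    show "differential tuple_complex i w \<in> coord_vecs UNIV (?n ^ i)"
      using differential_in_coord_vecs[of tuple_complex i w] by simp
    fix a c assume c: "c < ?n ^ i"
    have "strand i a (differential tuple_complex i w) c
        = (\<Sum>b<?n ^ Suc i. if b mod ?n = J a \<and> a \<noteq> 0
            then strand i a v (b div ?n) * face_coeff ?n i b c else 0)"
      unfolding strand_differential[OF c] by (intro sum.cong refl) (simp only: strand_w lessThan_iff, simp)
    also have "\<dots> = strand i a v c"
    proof (cases "a = 0")
      case False
      have "(\<Sum>b<?n ^ Suc i. if b mod ?n = J a then strand i a v (b div ?n) * face_coeff ?n i b c else 0)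
          = (\<Sum>b<?n ^ i. strand i a v b * face_coeff ?n i (J a + ?n * b) c)"
        using J(1)[OF False] by (simp only: sum_digits) simp
      then show ?thesis using False contract[OF J(1)[OF False] c] by simp
    qed (simp add: zero c)
    finally show "strand i a v c = strand i a (differential tuple_complex i w) c" by simp
  qed
  moreover have "w \<in> coord_vecs UNIV (?n ^ Suc i)" by (simp add: coord_vecs_def w_def)
  ultimately show ?thesis by blast
qed

lemma strand_zero_Suc: "strand (Suc i) 0 v b = 0"
proof -
  have "\<not> mono_dvd (ind (tuple_set (Suc i) b)) 0"
    unfolding mono_dvd_iff_lookup_le by (auto simp: lookup_ind)
  then show ?thesis unfolding strand_def by (rule if_not_P)
qed

lemma augmentation_tuple_complex: "augmentation tuple_complex v = strand 0 0 v 0"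
  by (simp add: augmentation_def strand_def) (simp add: tuple_complex_def ind_def)

text \<open>
  For cycles \<open>v\<close> the last term in \<open>d (j # v) = v - j # d v\<close> vanishes, so strands are
  contractible. Nonempty tuples have nonzero multidegree; hence only the empty tuple contributes
  in multidegree 0, and there the augmentation takes over.
\<close>

lemma tuple_complex_resolution:
  "free_resolution_of_field (tuple_complex :: ('n::finite, 'k::field) free_complex)"
  unfolding free_resolution_of_field_def
proof (intro conjI allI)
  let ?Q = "tuple_complex :: ('n, 'k) free_complex"
  show "multigraded ?Q"
    unfolding multigraded_def
  proof (intro conjI allI impI ballI)
    fix i b c m
    assume "m \<in> Poly_Mapping.keys (entry ?Q i b c)"
    then have nz: "(face_coeff CARD('n) i b c :: 'k) \<noteq> 0"
      and m: "m = ind (tuple_set (Suc i) b) - ind (tuple_set i c)"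
      by (auto simp: tuple_complex_def split: if_splits simp del: tuple_set.simps face_coeff.simps)
    obtain t where "ind (tuple_set (Suc i) b :: 'n set) = ind (tuple_set i c) + t"
      using ind_mono[OF face_coeff_nonzero_subset[OF nz]] by blast
    then show "m + bdeg ?Q i c = bdeg ?Q (Suc i) b"
      by (simp add: m tuple_complex_def add.commute del: tuple_set.simps)
  qed (simp add: tuple_complex_def ind_def)
  show "augmentation ?Q ` coord_vecs UNIV (rank ?Q 0) = UNIV"
  proof -
    have "x \<in> augmentation ?Q ` coord_vecs UNIV (rank ?Q 0)" for x
      by (rule image_eqI[of _ _ "\<lambda>b. if b = 0 then Poly_Mapping.single 0 x else 0"])
        (simp_all add: augmentation_tuple_complex strand_def ind_def coord_vecs_def)
    then show ?thesis by blast
  qed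
  show "{v \<in> coord_vecs UNIV (rank ?Q 0). augmentation ?Q v = 0}
      = differential ?Q 0 ` coord_vecs UNIV (rank ?Q 1)"
  proof (intro subset_antisym subsetI)
    fix v assume "v \<in> {v \<in> coord_vecs UNIV (rank ?Q 0). augmentation ?Q v = 0}"
    then have "v \<in> differential ?Q 0 ` coord_vecs UNIV (CARD('n) ^ Suc 0)"
      by (intro boundary_if_strands_contractible) (simp_all add: augmentation_tuple_complex)
    then show "v \<in> differential ?Q 0 ` coord_vecs UNIV (rank ?Q 1)" by simp
  next
    fix v assume "v \<in> differential ?Q 0 ` coord_vecs UNIV (rank ?Q 1)"
    then obtain w where w: "v = differential ?Q 0 w" by blast
    have "augmentation ?Q v = 0"
      unfolding w augmentation_tuple_complex
      by (subst strand_differential) (simp_all add: strand_zero_Suc)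
    then show "v \<in> {v \<in> coord_vecs UNIV (rank ?Q 0). augmentation ?Q v = 0}"
      using differential_in_coord_vecs[of ?Q 0 w] by (simp add: w)
  qed
  fix i
  show "{v \<in> coord_vecs UNIV (rank ?Q (Suc i)). differential ?Q i v = (\<lambda>_. 0)}
      = differential ?Q (Suc i) ` coord_vecs UNIV (rank ?Q (Suc (Suc i)))"
  proof (intro subset_antisym subsetI)
    fix v assume "v \<in> {v \<in> coord_vecs UNIV (rank ?Q (Suc i)). differential ?Q i v = (\<lambda>_. 0)}"
    then have v: "v \<in> coord_vecs UNIV (CARD('n) ^ Suc i)" and dv: "differential ?Q i v = (\<lambda>_. 0)" by simp_all
    have cycle: "(\<Sum>b<CARD('n) ^ Suc i. strand (Suc i) a v b * face_coeff CARD('n) i b c) = 0"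
      if "c < CARD('n) ^ i" for a c
      using strand_differential[OF that, of a v] unfolding dv by (simp only: strand_null)
    have "v \<in> differential ?Q (Suc i) ` coord_vecs UNIV (CARD('n) ^ Suc (Suc i))"
    proof (rule boundary_if_strands_contractible[OF v strand_zero_Suc])
      fix a :: "'n \<Rightarrow>\<^sub>0 nat" and j c
      assume j: "j < CARD('n)" and c: "c < CARD('n) ^ Suc i"
      have cd: "c div CARD('n) < CARD('n) ^ i" using c by (simp add: less_mult_imp_div_less mult.commute)
      have "(\<Sum>b<CARD('n) ^ Suc i. strand (Suc i) a v b * face_coeff CARD('n) (Suc i) (j + CARD('n) * b) c)
          = (\<Sum>b<CARD('n) ^ Suc i. (if b = c then strand (Suc i) a v c else 0)
            - (if c mod CARD('n) = j then strand (Suc i) a v b * face_coeff CARD('n) i b (c div CARD('n)) else 0))"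
        using j by (intro sum.cong refl) (auto simp: right_diff_distrib)
      also have "\<dots> = strand (Suc i) a v c"
        using c cycle[OF cd] by (cases "c mod CARD('n) = j") (simp_all add: sum_subtractf del: power_Suc)
      finally show "(\<Sum>b<CARD('n) ^ Suc i. strand (Suc i) a v b * face_coeff CARD('n) (Suc i) (j + CARD('n) * b) c)
          = strand (Suc i) a v c" .
    qed
    then show "v \<in> differential ?Q (Suc i) ` coord_vecs UNIV (rank ?Q (Suc (Suc i)))" by simp
  next
    fix v assume "v \<in> differential ?Q (Suc i) ` coord_vecs UNIV (rank ?Q (Suc (Suc i)))"
    then show "v \<in> {v \<in> coord_vecs UNIV (rank ?Q (Suc i)). differential ?Q i v = (\<lambda>_. 0)}"
      using differential_in_coord_vecs[of ?Q "Suc i"] by (auto simp: differential_differential_tuple_complex simp del: rank_tuple_complex)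
  qed
qed


section \<open>Non-vanishing of the first Tor module\<close>

text \<open>
  In the resolution by tuples, \<open>x\<^sup>a / x\<^sub>i \<cdot> e\<^sub>i - x\<^sup>a / x\<^sub>j \<cdot> e\<^sub>j\<close> is a cycle. It is not a
  boundary, since the sum of the coefficients at the vertices in \<open>C\<close> equals 1 for
  it, while for the boundary of a pair \<open>(p, q)\<close> with coefficients in \<open>J\<close> it is 0:
  unless \<open>p = q\<close>, the pair is an edge of the shift graph, so its ends are both in \<open>C\<close> or
  both outside.
\<close>

lemma tor_nonzero_if_shift_separated:
  fixes A :: "('n::finite \<Rightarrow>\<^sub>0 nat) set" and J :: "('n, 'k::field) mpoly set"
  assumes J: "J = ideal_gen (xpow ` A)"
    and ij: "shift_vertex J a i" "shift_vertex J a j" "i \<in> C" "j \<notin> C"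
    and closed: "\<And>p q. p \<in> C \<Longrightarrow> shift_edge J a p q \<Longrightarrow> q \<in> C"
  shows "tor_nonzero 1 J a"
proof -
  let ?n = "CARD('n)" and ?Q = "tuple_complex :: ('n, 'k) free_complex"
  obtain mi where mi: "a = mi + Poly_Mapping.single i 1" "xpow mi \<in> J"
    using ij(1) by (auto simp: shift_vertex_def)
  obtain mj where mj: "a = mj + Poly_Mapping.single j 1" "xpow mj \<in> J"
    using ij(2) by (auto simp: shift_vertex_def)
  define g :: "'n \<Rightarrow> ('n, 'k) mpoly"
    where "g x = (if x = i then xpow mi else if x = j then - xpow mj else 0)" for x
  define v where "v b = (if b < ?n then g (nth_var b) else 0)" for b
  have gJ: "g x \<in> J" for x
    using mi(2) mj(2) by (simp add: g_def J ring_module.span_neg ring_module.span_zero)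
  have reindex: "(\<Sum>b<?n. h (nth_var b)) = (\<Sum>x\<in>UNIV. h x)" for h :: "'n \<Rightarrow> 'b::comm_monoid_add"
    using bij_nth_var[where 'n = 'n] by (rule sum.reindex_bij_betw)
  have deg1: "ind (tuple_set (Suc 0) b) = Poly_Mapping.single (nth_var b :: 'n) 1" if "b < ?n" for b
    using that by (simp add: ind_def)
  have "differential ?Q 0 v = (\<lambda>_. 0)"
  proof
    fix c
    have "(\<Sum>b<?n. v b * Poly_Mapping.single (ind (tuple_set (Suc 0) b)) 1)
        = (\<Sum>b<?n. g (nth_var b) * xpow (Poly_Mapping.single (nth_var b) 1))"
      by (intro sum.cong refl) (simp add: v_def deg1 xpow_def del: tuple_set.simps)
    also have "\<dots> = (\<Sum>x\<in>UNIV. g x * xpow (Poly_Mapping.single x 1))" by (rule reindex)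
    also have "\<dots> = (\<Sum>x\<in>UNIV. (if x = i then xpow a else 0) - (if x = j then xpow a else 0))"
    proof (intro sum.cong refl)
      fix x
      have "i \<noteq> j" using ij by blast
      then show "g x * xpow (Poly_Mapping.single x 1)
          = (if x = i then xpow a else 0) - (if x = j then xpow a else 0)"
        by (auto simp: g_def mi(1) xpow_add) (simp_all flip: xpow_add mi(1) mj(1) add: mi(1)[symmetric, simplified] mj(1)[symmetric, simplified])
    qed
    also have "\<dots> = 0" by (simp add: sum_subtractf)
    finally show "differential ?Q 0 v c = 0"
      by (simp add: differential_def tuple_complex_def ind_def[of "{}"] del: tuple_set.simps(2))
  qed
  moreover have "v \<in> coord_vecs J (rank ?Q 1)"
    using gJ by (simp add: coord_vecs_def v_def)
  ultimately have cycle: "v \<in> tensor_cycles ?Q 1 J" by (simp add: tensor_cycles_def)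
  have hom: "v \<in> homogeneous_vecs ?Q 1 a"
    unfolding homogeneous_vecs_def
  proof (intro CollectI allI impI ballI)
    fix b m assume b: "b < rank ?Q 1" and m: "m \<in> Poly_Mapping.keys (v b)"
    have "bdeg ?Q 1 b = Poly_Mapping.single (nth_var b) 1"
      using b deg1[of b] by (simp add: tuple_complex_def)
    then show "m + bdeg ?Q 1 b = a"
      using b m mi(1) mj(1) by (auto simp: v_def g_def xpow_def split: if_splits)
  qed
  have "v \<notin> tensor_boundaries ?Q 1 J"
  proof
    assume "v \<in> tensor_boundaries ?Q 1 J"
    then obtain w where w: "w \<in> coord_vecs J (?n ^ Suc (Suc 0))" "v = differential ?Q (Suc 0) w"
      by (auto simp: tensor_boundaries_def)
    let ?in_C = "\<lambda>b. if nth_var b \<in> C then 1 else 0 :: 'k"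
    have strand_v: "strand (Suc 0) a v b = (if nth_var b = i then 1 else 0) - (if nth_var b = j then 1 else 0)"
      if b: "b < ?n" for b
    proof -
      have "i \<noteq> j" using ij by blast
      have "a - Poly_Mapping.single i 1 = mi" "a - Poly_Mapping.single j 1 = mj"
        using mi(1) mj(1) by (metis add_diff_cancel_right')+
      moreover have "mono_dvd (Poly_Mapping.single i 1) a" "mono_dvd (Poly_Mapping.single j 1) a"
        using mi(1) mj(1) by (metis add.commute)+
      ultimately show ?thesis
        unfolding strand_def deg1[OF b] using b \<open>i \<noteq> j\<close>
        by (simp add: v_def g_def xpow_def del: One_nat_def)
    qed
    have "(\<Sum>b<?n. ?in_C b * strand (Suc 0) a v b)
        = (\<Sum>b<?n. (\<lambda>x. if x = i then 1 else 0 :: 'k) (nth_var b))"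
      using ij(3,4) by (intro sum.cong refl) (auto simp: strand_v)
    also have "\<dots> = 1" unfolding reindex[of "\<lambda>x. if x = i then 1 else 0 :: 'k"] by simp
    finally have one: "(\<Sum>b<?n. ?in_C b * strand (Suc 0) a v b) = 1" .
    have "(\<Sum>b<?n. ?in_C b * strand (Suc 0) a v b)
        = (\<Sum>b<?n. \<Sum>s<?n ^ Suc (Suc 0). ?in_C b * (strand (Suc (Suc 0)) a w s * face_coeff ?n (Suc 0) s b))"
      unfolding w(2)
      by (intro sum.cong refl) (simp add: strand_differential sum_distrib_left del: power_Suc face_coeff.simps)
    also have "\<dots> = (\<Sum>s<?n ^ Suc (Suc 0). strand (Suc (Suc 0)) a w s
        * (\<Sum>b<?n. ?in_C b * face_coeff ?n (Suc 0) s b))"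
      by (subst sum.swap) (simp only: sum_distrib_left mult.left_commute)
    also have "\<dots> = 0"
    proof (intro sum.neutral ballI)
      fix s assume "s \<in> {..<?n ^ Suc (Suc 0)}"
      then have s: "s < ?n ^ Suc (Suc 0)" by simp
      define p q where "p = (nth_var (s mod ?n) :: 'n)" and "q = (nth_var (s div ?n) :: 'n)"
      have sd: "s div ?n < ?n" using s by (simp add: less_mult_imp_div_less)
      have deg2: "ind (tuple_set (Suc (Suc 0)) s) = ind {p, q}"
        using sd by (simp add: p_def q_def)
      have "(\<Sum>b<?n. ?in_C b * face_coeff ?n (Suc 0) s b)
          = (\<Sum>b<?n. (if b = s div ?n then ?in_C (s div ?n) else 0) - (if b = s mod ?n then ?in_C (s mod ?n) else 0))"
        by (intro sum.cong refl) (auto simp: right_diff_distrib)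
      also have "\<dots> = (if q \<in> C then 1 else 0) - (if p \<in> C then 1 else 0)"
        using sd by (simp add: sum_subtractf p_def q_def)
      finally have diff: "(\<Sum>b<?n. ?in_C b * face_coeff ?n (Suc 0) s b)
          = (if q \<in> C then 1 else 0) - (if p \<in> C then 1 else 0)" .
      show "strand (Suc (Suc 0)) a w s * (\<Sum>b<?n. ?in_C b * face_coeff ?n (Suc 0) s b) = 0"
      proof (cases "strand (Suc (Suc 0)) a w s = 0 \<or> p = q")
        case True
        then show ?thesis unfolding diff by auto
      next
        case False
        then have nz: "strand (Suc (Suc 0)) a w s \<noteq> 0" and "p \<noteq> q" by auto
        from nz obtain m where a: "a = ind {p, q} + m" and "Poly_Mapping.lookup (w s) m \<noteq> 0"
          unfolding strand_def deg2 by (auto split: if_splits)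
        then have m: "m \<in> Poly_Mapping.keys (w s)" by (simp add: in_keys_iff)
        have "w s \<in> J" using w(1) s by (simp add: coord_vecs_def del: power_Suc)
        then have "\<exists>u\<in>A. mono_dvd u m" using m unfolding J in_monomial_ideal_iff by (rule bspec)
        then have "xpow m \<in> J" unfolding J xpow_in_monomial_ideal_iff .
        moreover have "a = m + Poly_Mapping.single p 1 + Poly_Mapping.single q 1"
          "a = m + Poly_Mapping.single q 1 + Poly_Mapping.single p 1"
          unfolding a ind_doubleton[OF \<open>p \<noteq> q\<close>] by (simp_all only: ac_simps)
        ultimately have "shift_edge J a p q" "shift_edge J a q p" unfolding shift_edge_def by blast+
        then have "p \<in> C \<longleftrightarrow> q \<in> C" using closed by blast
        then show ?thesis unfolding diff by auto
      qed
    qed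
    finally show False using one by simp
  qed
  then show ?thesis
    unfolding tor_nonzero_def using tuple_complex_resolution cycle hom by blast
qed


section \<open>The first homological shift ideal of a power of an edge ideal\<close>

text \<open>
  The shift graph is disconnected. It thus has a vertex, which bounds the degree of
  \<open>a\<close> from below and shows that there is a generator at all, so that the generating degree
  is \<open>2 * k\<close>; the bound from above is the connectedness outside the non-pure power.
\<close>

lemma tor_nonzero_edge_ideal_pow:
  fixes E :: "'n::finite set set" and J :: "('n, 'k::field) mpoly set"
  assumes E: "simple_graph E" and k: "k \<ge> 1" and J: "J = ideal_gen (xpow ` pow_exps E k)"
    and tor: "tor_nonzero 1 J a"
    and nonpure: "xpow a \<notin> (ideal_gen (xpow ` nonpure_exps E (k + 1)) :: ('n, 'k) mpoly set)"
  shows "total_deg a = gen_degree J + 1"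
proof -
  have "\<not> (\<forall>i j. shift_vertex J a i \<longrightarrow> shift_vertex J a j \<longrightarrow> (shift_edge J a)\<^sup>*\<^sup>* i j)"
  proof
    assume conn: "\<forall>i j. shift_vertex J a i \<longrightarrow> shift_vertex J a j \<longrightarrow> (shift_edge J a)\<^sup>*\<^sup>* i j"
    obtain P :: "('n, 'k) free_complex" where P: "free_resolution_of_field P"
      "\<not> tensor_cycles P 1 J \<inter> homogeneous_vecs P 1 a \<subseteq> tensor_boundaries P 1 J \<inter> homogeneous_vecs P 1 a"
      using tor unfolding tor_nonzero_def by blast
    then obtain v where "v \<in> tensor_cycles P 1 J" "v \<in> homogeneous_vecs P 1 a" "v \<notin> tensor_boundaries P 1 J"
      by blast
    then show False
      using cycle_boundary_if_shift_connected[OF P(1), of "xpow ` pow_exps E k" a v] conn unfolding J by blast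
  qed
  then obtain i j where ij: "shift_vertex J a i" "shift_vertex J a j" "\<not> (shift_edge J a)\<^sup>*\<^sup>* i j" by blast
  obtain u where u: "u \<in> pow_exps E k" "mono_dvd (u + Poly_Mapping.single i 1) a"
    using ij(1) unfolding J shift_vertex_monomial_ideal_iff by blast
  have deg: "gen_degree J = 2 * k"
    unfolding J using u(1) by (intro gen_degree_equigenerated) (auto simp: total_deg_pow_exps[OF E])
  have "total_deg a \<ge> 2 * k + 1"
    using u(2) by (auto simp: total_deg_add total_deg_pow_exps[OF E u(1)])
  moreover have "\<not> total_deg a > 2 * k + 1"
    using shift_connected_outside_nonpure[OF E k J _ _ ij(1,2)] ij(3) nonpure
    unfolding xpow_in_monomial_ideal_iff by blast
  ultimately show ?thesis using deg by simp
qed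

lemma nonpure_in_HS:
  fixes E :: "'n::finite set set" and J :: "('n, 'k::field) mpoly set"
  assumes E: "simple_graph E" and J: "J = ideal_gen (xpow ` pow_exps E k)"
    and w: "w \<in> nonpure_exps E (k + 1)"
  shows "xpow w \<in> HS 1 J"
proof -
  obtain u v where uv: "u \<in> pow_exps E k" "v \<in> pow_exps E k" "u \<noteq> v" "mono_dvd u w" "mono_dvd v w"
    using nonpure_exps_two_divisors[OF w] .
  obtain a C i j where a: "mono_dvd a w" "shift_vertex J a i" "shift_vertex J a j"
    "i \<in> C" "j \<notin> C" "\<forall>p q. p \<in> C \<longrightarrow> shift_edge J a p q \<longrightarrow> q \<in> C"
    by (rule two_divisors_separated[OF J total_deg_pow_exps[OF E] uv])
  have "tor_nonzero 1 J a" using tor_nonzero_if_shift_separated[OF J a(2-5)] a(6) by blast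
  then have "(xpow w :: ('n, 'k) mpoly) \<in> ideal_gen (xpow ` {a. tor_nonzero 1 J a})"
    unfolding xpow_in_monomial_ideal_iff using a(1) by blast
  moreover have "xpow ` {a. tor_nonzero 1 J a} = ({xpow a | a. tor_nonzero 1 J a} :: ('n, 'k) mpoly set)" by blast
  ultimately show ?thesis unfolding HS_def by simp
qed

theorem theorem2p1:
  fixes E :: "'n::finite set set" and I :: "('n, 'k::field) mpoly set" and k :: nat
  assumes "simple_graph E" and "I = edge_ideal E" and "k \<ge> 1"
  shows "HS 1 (ideal_pow I k) = Lin 1 (ideal_pow I k) + nonpure_power I (k + 1)"
proof -
  define J :: "('n, 'k) mpoly set" where "J = ideal_pow I k"
  have J: "J = ideal_gen (xpow ` pow_exps E k)"
    unfolding J_def assms(2) by (rule edge_ideal_pow_eq[OF assms(1)])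
  have N: "nonpure_power I (k + 1) = ideal_gen (xpow ` nonpure_exps E (k + 1))"
    unfolding assms(2) using assms(3) by (intro nonpure_power_edge_ideal_eq[OF assms(1)]) simp
  let ?L = "{xpow a | a. xpow a \<in> HS 1 J \<and> total_deg a = gen_degree J + 1} :: ('n, 'k) mpoly set"
  let ?N = "xpow ` nonpure_exps E (k + 1) :: ('n, 'k) mpoly set"
  have "HS 1 J = ideal_gen {xpow a | a. tor_nonzero 1 J a}" by (rule HS_def)
  also have "\<dots> = ideal_gen (?L \<union> ?N)"
  proof (rule ideal_gen_eqI)
    show "{xpow a | a. tor_nonzero 1 J a} \<subseteq> ideal_gen (?L \<union> ?N)"
    proof
      fix f :: "('n, 'k) mpoly" assume "f \<in> {xpow a | a. tor_nonzero 1 J a}"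
      then obtain a where f: "f = xpow a" and tor: "tor_nonzero 1 J a" by blast
      have "xpow a \<in> ideal_gen (?L \<union> ?N)"
      proof (cases "xpow a \<in> ideal_gen ?N")
        case True
        then show ?thesis by (rule ring_module.span_mono[OF Un_upper2, THEN subsetD])
      next
        case False
        have "xpow a \<in> HS 1 J" unfolding HS_def using tor by (auto intro!: ring_module.span_base)
        moreover have "total_deg a = gen_degree J + 1"
          by (rule tor_nonzero_edge_ideal_pow[OF assms(1,3) J tor False])
        ultimately have "xpow a \<in> ?L \<union> ?N" by auto
        then show ?thesis by (rule ring_module.span_base)
      qed
      then show "f \<in> ideal_gen (?L \<union> ?N)" by (simp only: f)
    qed
    show "?L \<union> ?N \<subseteq> ideal_gen {xpow a | a. tor_nonzero 1 J a}"
      unfolding HS_def[symmetric] using nonpure_in_HS[OF assms(1) J] by auto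
  qed
  also have "\<dots> = ideal_gen ?L + ideal_gen ?N"
    unfolding ring_module.span_Un set_plus_def by auto
  also have "ideal_gen ?L = Lin 1 J" by (simp add: Lin_def degree_part_def)
  finally show ?thesis unfolding J_def N .
qed

end
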